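(* Let $E$ be a Banach lattice with dual $E'$. Then the following hold. (1) For a non-empty bounded subset $A\subset E$, the following conditions are equivalent. (a) $A$ is L-weakly compact. (b) $\sup_{x\in A}|x'_n(x)|\to 0$ for every norm bounded $uaw^*$-null sequence $(x'_n)\subset E'$. (c) $\sup_{x\in A}|x'_n(x)|\to 0$ for every norm bounded $uaw$-null sequence $(x'_n)\subset E'$. (d) $\sup_{x\in A}|x'_n(x)|\to 0$ for every norm bounded $uo$-null sequence $(x'_n)\subset E'$. (2) A non-empty bounded subset $B\subset E'$ is L-weakly compact if and only if $\sup_{x'\in B}|x'(x_n)|\to 0$ for every norm bounded $uaw$-null sequence $(x_n)\subset E$.
   Context: A bounded subset $A$ of a Banach lattice is L-weakly compact if every disjoint sequence in the solid hull of $A$ converges to zero in norm (a sequence $(x_n)$ is disjoint if $|x_n|\wedge|x_m|=0$ for $n\neq m$). A net $(x_\alpha)_{\alpha\in A}$ in a Riesz space is order convergent to $x$ if there is a net $(y_\beta)_{\beta\in B}$, possibly over a different index set, with $y_\beta\downarrow 0$ such that for each $\beta$ there is $\alpha_0$ with $|x_\alpha-x|\le y_\beta$ for all $\alpha\ge\alpha_0$. In a Banach lattice $G$, a net $(x_\alpha)$ is $uo$-convergent (unbounded order convergent), respectively $uaw$-convergent (unbounded absolute weakly convergent), to $x$ if for every $u\in G_+$ the net $|x_\alpha-x|\wedge u$ converges to $0$ in order, respectively weakly, i.e. in $\sigma(G,G')$. In a dual Banach lattice $E'$, a net $(x'_\alpha)$ is $uaw^*$-convergent (unbounded absolute weak*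 convergent) to $x'$ if $|x'_\alpha-x'|\wedge u'\to 0$ in $\sigma(E',E)$ for every $u'\in E'_+$. A sequence is $uo$-, $uaw$- or $uaw^*$-null if it converges to $0$ in the respective sense. *)

theory Defs
  imports "HOL-Analysis.Analysis" "HOL-Library.Lattice_Algebras"
begin

section \<open>Banach lattices\<close>

class banach_lattice = lattice_ab_group_add_abs + ordered_real_vector + banach +
  assumes norm_mono_abs: "\<bar>x\<bar> \<le> \<bar>y\<bar> \<Longrightarrow> norm x \<le> norm y"

text \<open>
  Type classes cannot make \<open>'a \<Rightarrow>\<^sub>L real\<close> an ordered space without saying something about
  \<open>'a \<Rightarrow>\<^sub>L 'b\<close> for more general \<open>'b\<close>. We use the Dedekind complete AM-spaces with unit (the closed
  unit ball is the order interval from \<open>-1\<close> to \<open>1\<close>) as codomains: for these, by the theorem of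
  Riesz and Kantorovich, the bounded operators with the operator norm form a Banach lattice.
  Only the instance \<open>'b = real\<close> matters, where \<open>'a \<Rightarrow>\<^sub>L real\<close> is the dual Banach lattice with its
  usual norm and order.
\<close>

class am_space_unit = banach_lattice + conditionally_complete_lattice + one +
  assumes norm_le_1_iff: "norm x \<le> 1 \<longleftrightarrow> \<bar>x\<bar> \<le> 1"

instance real :: am_space_unit
  by standard auto

context banach_lattice
begin

lemma prt_diff: "x = pprt x - pprt (- x)"
  using prts[of x] by (simp add: pprt_neg)

lemma abs_prt_sum: "\<bar>x\<bar> = pprt x + pprt (- x)"
  using abs_prts[of x] by (simp add: pprt_neg)

lemma norm_pprt_le: "norm (pprt x) \<le> norm x"
proof (rule norm_mono_abs)
  have "pprt x \<le> pprt x + pprt (- x)"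
    using add_left_mono[OF zero_le_pprt[of "- x"], of "pprt x"] by simp
  then show "\<bar>pprt x\<bar> \<le> \<bar>x\<bar>"
    by (simp add: abs_prt_sum[of x])
qed

end

lemma abs_scaleR_nonneg:
  fixes x :: "'a::banach_lattice"
  assumes "0 \<le> r"
  shows "\<bar>r *\<^sub>R x\<bar> = r *\<^sub>R \<bar>x\<bar>"
proof (cases "r = 0")
  case False
  with assms have r: "r > 0" by simp
  have le: "\<bar>s *\<^sub>R y\<bar> \<le> s *\<^sub>R \<bar>y\<bar>" if "s > 0" for s and y :: 'a
  proof (rule abs_leI)
    show "s *\<^sub>R y \<le> s *\<^sub>R \<bar>y\<bar>"
      using that by (intro scaleR_left_mono) (auto simp: abs_ge_self)
    show "- (s *\<^sub>R y) \<le> s *\<^sub>R \<bar>y\<bar>"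
      unfolding scaleR_minus_right[symmetric] using that
      by (intro scaleR_left_mono) (auto simp: abs_ge_minus_self)
  qed
  have "\<bar>inverse r *\<^sub>R (r *\<^sub>R x)\<bar> \<le> inverse r *\<^sub>R \<bar>r *\<^sub>R x\<bar>"
    using r by (intro le) simp
  then have "\<bar>x\<bar> \<le> inverse r *\<^sub>R \<bar>r *\<^sub>R x\<bar>"
    using r by simp
  then have "r *\<^sub>R \<bar>x\<bar> \<le> r *\<^sub>R (inverse r *\<^sub>R \<bar>r *\<^sub>R x\<bar>)"
    using r by (intro scaleR_left_mono) auto
  with le[OF r, of x] r show ?thesis by simp
qed simp

lemma unit_nonneg: "0 \<le> (1::'a::am_space_unit)"
  using norm_le_1_iff[of "0::'a"] by simp

lemma abs_le_norm_unit:
  fixes x :: "'a::am_space_unit"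
  shows "\<bar>x\<bar> \<le> norm x *\<^sub>R 1"
proof (cases "x = 0")
  case False
  have "norm (inverse (norm x) *\<^sub>R x) \<le> 1"
    using False by simp
  then have "\<bar>inverse (norm x) *\<^sub>R x\<bar> \<le> 1"
    by (simp only: norm_le_1_iff)
  then have "inverse (norm x) *\<^sub>R \<bar>x\<bar> \<le> 1"
    by (simp add: abs_scaleR_nonneg)
  then have "norm x *\<^sub>R (inverse (norm x) *\<^sub>R \<bar>x\<bar>) \<le> norm x *\<^sub>R 1"
    by (intro scaleR_left_mono) auto
  with False show ?thesis by simp
qed simp

lemma norm_le_if_abs_le:
  fixes x :: "'a::am_space_unit"
  assumes "\<bar>x\<bar> \<le> r *\<^sub>R 1" "0 \<le> r"
  shows "norm x \<le> r"
proof -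
  have "norm (1::'a) \<le> 1"
    unfolding norm_le_1_iff using unit_nonneg[where 'a='a] by simp
  moreover have "norm x \<le> norm (r *\<^sub>R (1::'a))"
    using assms unit_nonneg[where 'a='a]
    by (intro norm_mono_abs) (simp add: abs_scaleR_nonneg)
  ultimately show ?thesis
    using assms(2) mult_left_le[of "norm (1::'a)" r] by simp
qed


section \<open>The order on bounded operators\<close>

text \<open>The positive part of a bounded operator, first on the positive cone:\<close>

definition cone_part :: "('a::banach_lattice \<Rightarrow>\<^sub>L 'b::am_space_unit) \<Rightarrow> 'a \<Rightarrow> 'b" where
  "cone_part h x = (SUP y\<in>{0..x}. blinfun_apply h y)"

definition pos_part :: "('a::banach_lattice \<Rightarrow>\<^sub>L 'b::am_space_unit) \<Rightarrow> 'a \<Rightarrow>\<^sub>L 'b" where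
  "pos_part h = Blinfun (\<lambda>x. cone_part h (pprt x) - cone_part h (pprt (- x)))"

lemma le_if_norm_le:
  fixes x :: "'a::am_space_unit"
  assumes "norm x \<le> r" shows "x \<le> r *\<^sub>R 1"
proof -
  have "x \<le> \<bar>x\<bar>" by (rule abs_ge_self)
  also have "\<dots> \<le> norm x *\<^sub>R 1" by (rule abs_le_norm_unit)
  also have "\<dots> \<le> r *\<^sub>R 1" using assms unit_nonneg by (rule scaleR_right_mono)
  finally show ?thesis .
qed

lemma blinfun_norm_interval:
  fixes h :: "'a::banach_lattice \<Rightarrow>\<^sub>L 'b::am_space_unit"
  assumes "\<bar>y\<bar> \<le> \<bar>x\<bar>"
  shows "norm (blinfun_apply h y) \<le> norm h * norm x"
  using norm_blinfun[of h y] norm_mono_abs[OF assms]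
  by (meson mult_left_mono norm_ge_zero order_trans)

lemma cone_part_bound:
  fixes h :: "'a::banach_lattice \<Rightarrow>\<^sub>L 'b::am_space_unit"
  assumes "0 \<le> y" "y \<le> x"
  shows "blinfun_apply h y \<le> (norm h * norm x) *\<^sub>R 1"
proof (rule le_if_norm_le, rule blinfun_norm_interval)
  show "\<bar>y\<bar> \<le> \<bar>x\<bar>" using assms order_trans[OF assms] by simp
qed

lemma cone_part_bdd:
  fixes h :: "'a::banach_lattice \<Rightarrow>\<^sub>L 'b::am_space_unit"
  shows "bdd_above (blinfun_apply h ` {0..x})"
  by (rule bdd_aboveI2[of _ _ "(norm h * norm x) *\<^sub>R 1"]) (auto intro: cone_part_bound)

lemma cone_part_upper: "0 \<le> y \<Longrightarrow> y \<le> x \<Longrightarrow> blinfun_apply h y \<le> cone_part h x"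
  unfolding cone_part_def by (rule cSUP_upper) (auto intro: cone_part_bdd)

lemma cone_part_least:
  "0 \<le> x \<Longrightarrow> (\<And>y. 0 \<le> y \<Longrightarrow> y \<le> x \<Longrightarrow> blinfun_apply h y \<le> c) \<Longrightarrow> cone_part h x \<le> c"
  unfolding cone_part_def by (rule cSUP_least) auto

lemma cone_part_nonneg: "0 \<le> x \<Longrightarrow> 0 \<le> cone_part h x"
  using cone_part_upper[of 0 x h] by (simp add: blinfun.zero_right)

lemma cone_part_add:
  fixes h :: "'a::banach_lattice \<Rightarrow>\<^sub>L 'b::am_space_unit"
  assumes "0 \<le> x" "0 \<le> y"
  shows "cone_part h (x + y) = cone_part h x + cone_part h y"
proof (rule antisym)
  show "cone_part h (x + y) \<le> cone_part h x + cone_part h y"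
  proof (rule cone_part_least)
    fix z assume z: "0 \<le> z" "z \<le> x + y"
    have a: "0 \<le> inf z x" "inf z x \<le> x" using z assms by auto
    have "z - inf z x = sup 0 (z - x)"
      by (simp only: diff_inf_eq_sup) (simp add: add_sup_distrib_left)
    then have b: "0 \<le> z - inf z x" "z - inf z x \<le> y"
      using z assms by (auto simp: algebra_simps)
    have "blinfun_apply h z = blinfun_apply h (inf z x) + blinfun_apply h (z - inf z x)"
      by (simp add: blinfun.add_right[symmetric] del: diff_inf_eq_sup)
    also have "\<dots> \<le> cone_part h x + cone_part h y"
      by (intro add_mono cone_part_upper a b)
    finally show "blinfun_apply h z \<le> cone_part h x + cone_part h y" .
  qed (use assms in auto)
  have "cone_part h x \<le> cone_part h (x + y) - cone_part h y"
  proof (rule cone_part_least[OF assms(1)])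
    fix a assume a: "0 \<le> a" "a \<le> x"
    have "cone_part h y \<le> cone_part h (x + y) - blinfun_apply h a"
    proof (rule cone_part_least[OF assms(2)])
      fix b assume b: "0 \<le> b" "b \<le> y"
      have "blinfun_apply h (a + b) \<le> cone_part h (x + y)"
        using a b by (intro cone_part_upper add_mono) auto
      then show "blinfun_apply h b \<le> cone_part h (x + y) - blinfun_apply h a"
        by (simp add: blinfun.add_right algebra_simps)
    qed
    then show "blinfun_apply h a \<le> cone_part h (x + y) - cone_part h y"
      by (simp add: algebra_simps)
  qed
  then show "cone_part h x + cone_part h y \<le> cone_part h (x + y)"
    by (simp add: algebra_simps)
qed

lemma cone_part_scaleR:
  fixes h :: "'a::banach_lattice \<Rightarrow>\<^sub>L 'b::am_space_unit"
  assumes "0 < r" "0 \<le> x"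
  shows "cone_part h (r *\<^sub>R x) = r *\<^sub>R cone_part h x"
proof -
  have le: "cone_part h (s *\<^sub>R z) \<le> s *\<^sub>R cone_part h z" if s: "0 < s" and z: "0 \<le> z" for s z
  proof (rule cone_part_least)
    show "0 \<le> s *\<^sub>R z" using s z by (simp add: scaleR_nonneg_nonneg)
    fix y assume y: "0 \<le> y" "y \<le> s *\<^sub>R z"
    have "inverse s *\<^sub>R y \<le> inverse s *\<^sub>R (s *\<^sub>R z)"
      using y s by (intro scaleR_left_mono) auto
    then have "blinfun_apply h (inverse s *\<^sub>R y) \<le> cone_part h z"
      using y s by (intro cone_part_upper) (auto simp: scaleR_nonneg_nonneg)
    then have "s *\<^sub>R blinfun_apply h (inverse s *\<^sub>R y) \<le> s *\<^sub>R cone_part h z"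
      using s by (intro scaleR_left_mono) auto
    then show "blinfun_apply h y \<le> s *\<^sub>R cone_part h z"
      using s by (simp add: blinfun.scaleR_right)
  qed
  have "cone_part h (inverse r *\<^sub>R (r *\<^sub>R x)) \<le> inverse r *\<^sub>R cone_part h (r *\<^sub>R x)"
    using assms by (intro le) (auto simp: scaleR_nonneg_nonneg)
  then have "r *\<^sub>R cone_part h x \<le> r *\<^sub>R (inverse r *\<^sub>R cone_part h (r *\<^sub>R x))"
    using assms by (intro scaleR_left_mono) auto
  with le[OF assms] assms(1) show ?thesis by (simp add: antisym)
qed

lemma cone_part_norm:
  fixes h :: "'a::banach_lattice \<Rightarrow>\<^sub>L 'b::am_space_unit"
  assumes "0 \<le> x"
  shows "norm (cone_part h x) \<le> norm h * norm x"
proof (rule norm_le_if_abs_le)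
  have "cone_part h x \<le> (norm h * norm x) *\<^sub>R 1"
    by (rule cone_part_least[OF assms]) (rule cone_part_bound)
  then show "\<bar>cone_part h x\<bar> \<le> (norm h * norm x) *\<^sub>R 1"
    using cone_part_nonneg[OF assms, of h] by simp
qed simp

lemma pos_part_diff:
  fixes h :: "'a::banach_lattice \<Rightarrow>\<^sub>L 'b::am_space_unit"
  assumes "0 \<le> a" "0 \<le> b"
  shows "cone_part h (pprt (a - b)) - cone_part h (pprt (- (a - b))) =
    cone_part h a - cone_part h b"
proof -
  have "pprt (a - b) + b = pprt (- (a - b)) + a"
    using prt_diff[of "a - b"] by (simp add: algebra_simps)
  then have "cone_part h (pprt (a - b)) + cone_part h b =
      cone_part h (pprt (- (a - b))) + cone_part h a"
    using assms by (simp only: cone_part_add[symmetric] zero_le_pprt)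
  then show ?thesis by (simp add: algebra_simps)
qed

lemma bounded_linear_pos_part:
  fixes h :: "'a::banach_lattice \<Rightarrow>\<^sub>L 'b::am_space_unit"
  shows "bounded_linear (\<lambda>x. cone_part h (pprt x) - cone_part h (pprt (- x)))"
    (is "bounded_linear ?T")
proof (rule bounded_linear_intro[where K = "norm h + norm h"])
  show "?T (x + y) = ?T x + ?T y" for x y
  proof -
    have eq: "x + y = (pprt x + pprt y) - (pprt (- x) + pprt (- y))"
      by (subst prt_diff[of x], subst prt_diff[of y]) (simp only: add_diff_add)
    show ?thesis
      by (subst (1 2) eq, subst pos_part_diff)
        (simp_all add: cone_part_add)
  qed
  have pos: "?T (r *\<^sub>R x) = r *\<^sub>R ?T x" if "r > 0" for r x
  proof -
    have eq: "r *\<^sub>R x = r *\<^sub>R pprt x - r *\<^sub>R pprt (- x)"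
      using arg_cong[OF prt_diff[of x], of "scaleR r"] by (simp add: scaleR_diff_right)
    show ?thesis
      by (subst (1 2) eq, subst pos_part_diff)
        (use that in \<open>simp_all add: cone_part_scaleR scaleR_nonneg_nonneg scaleR_diff_right\<close>)
  qed
  show "?T (r *\<^sub>R x) = r *\<^sub>R ?T x" for r x
  proof (cases r "0::real" rule: linorder_cases)
    case less
    have "?T (r *\<^sub>R x) = - ?T (- (r *\<^sub>R x))" by simp
    also have "- (r *\<^sub>R x) = (- r) *\<^sub>R x" by simp
    also have "?T \<dots> = (- r) *\<^sub>R ?T x" using less by (intro pos) auto
    finally show ?thesis by simp
  qed (use pos in auto)
  show "norm (?T x) \<le> norm x * (norm h + norm h)" for x
  proof -
    have "norm (?T x) \<le> norm (cone_part h (pprt x)) + norm (cone_part h (pprt (- x)))"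
      by (rule norm_triangle_ineq4)
    also have "\<dots> \<le> norm h * norm (pprt x) + norm h * norm (pprt (- x))"
      by (intro add_mono cone_part_norm) auto
    also have "\<dots> \<le> norm h * norm x + norm h * norm x"
      using norm_pprt_le[of x] norm_pprt_le[of "- x"]
      by (intro add_mono mult_left_mono) auto
    finally show ?thesis by (simp add: algebra_simps)
  qed
qed

lemma pos_part_apply: "0 \<le> x \<Longrightarrow> blinfun_apply (pos_part h) x = cone_part h x"
  using pos_part_diff[of x 0 h]
  by (simp add: pos_part_def bounded_linear_Blinfun_apply[OF bounded_linear_pos_part])
    (simp add: cone_part_def blinfun.zero_right)

instantiation blinfun :: (banach_lattice, am_space_unit) banach_lattice
begin

definition less_eq_blinfun :: "('a \<Rightarrow>\<^sub>L 'b) \<Rightarrow> ('a \<Rightarrow>\<^sub>L 'b) \<Rightarrow> bool" where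
  "f \<le> g \<longleftrightarrow> (\<forall>x\<ge>0. blinfun_apply f x \<le> blinfun_apply g x)"

definition less_blinfun :: "('a \<Rightarrow>\<^sub>L 'b) \<Rightarrow> ('a \<Rightarrow>\<^sub>L 'b) \<Rightarrow> bool" where
  "(f :: 'a \<Rightarrow>\<^sub>L 'b) < g \<longleftrightarrow> f \<le> g \<and> \<not> g \<le> f"

definition sup_blinfun :: "('a \<Rightarrow>\<^sub>L 'b) \<Rightarrow> ('a \<Rightarrow>\<^sub>L 'b) \<Rightarrow> ('a \<Rightarrow>\<^sub>L 'b)" where
  "sup f g = f + pos_part (g - f)"

definition inf_blinfun :: "('a \<Rightarrow>\<^sub>L 'b) \<Rightarrow> ('a \<Rightarrow>\<^sub>L 'b) \<Rightarrow> ('a \<Rightarrow>\<^sub>L 'b)" where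
  "inf f g = f - pos_part (f - g)"

definition abs_blinfun :: "('a \<Rightarrow>\<^sub>L 'b) \<Rightarrow> ('a \<Rightarrow>\<^sub>L 'b)" where
  "\<bar>f :: 'a \<Rightarrow>\<^sub>L 'b\<bar> = sup f (- f)"

instance
proof
  fix f g k :: "'a \<Rightarrow>\<^sub>L 'b" and r s :: real
  note simps = less_eq_blinfun_def blinfun.add_left blinfun.diff_left blinfun.minus_left
    blinfun.scaleR_left blinfun.zero_left
  have pos_ub: "h \<le> pos_part h" and pos_nonneg: "0 \<le> pos_part h" for h :: "'a \<Rightarrow>\<^sub>L 'b"
    by (auto simp: simps pos_part_apply cone_part_nonneg intro: cone_part_upper)
  have pos_least: "pos_part h \<le> k" if "h \<le> k" "0 \<le> k" for h k :: "'a \<Rightarrow>\<^sub>L 'b"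
    unfolding less_eq_blinfun_def
  proof (intro allI impI)
    fix x :: 'a assume x: "0 \<le> x"
    have "cone_part h x \<le> blinfun_apply k x"
    proof (rule cone_part_least[OF x])
      fix y assume y: "0 \<le> y" "y \<le> x"
      have "blinfun_apply h y \<le> blinfun_apply k y" using that y by (simp add: simps)
      also have "0 \<le> blinfun_apply k (x - y)" using that y by (simp add: simps)
      then have "blinfun_apply k y \<le> blinfun_apply k x" by (simp add: blinfun.diff_right)
      finally show "blinfun_apply h y \<le> blinfun_apply k x" .
    qed
    then show "blinfun_apply (pos_part h) x \<le> blinfun_apply k x"
      by (simp add: pos_part_apply x)
  qed
  have diff_iff: "a \<le> b - c \<longleftrightarrow> a + c \<le> b" "a - c \<le> b \<longleftrightarrow> a \<le> b + c"
    for a b c :: "'a \<Rightarrow>\<^sub>L 'b"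
    by (simp_all add: simps algebra_simps)
  show "f < g \<longleftrightarrow> f \<le> g \<and> \<not> g \<le> f" by (rule less_blinfun_def)
  show "f \<le> f" by (simp add: simps)
  show "f \<le> g \<Longrightarrow> g \<le> k \<Longrightarrow> f \<le> k" by (auto simp: simps intro: order_trans)
  show "f = g" if "f \<le> g" "g \<le> f"
  proof (rule blinfun_eqI)
    fix x
    have "blinfun_apply f y = blinfun_apply g y" if "0 \<le> y" for y
      using that \<open>f \<le> g\<close> \<open>g \<le> f\<close> by (auto simp: simps intro: antisym)
    then have "blinfun_apply f (pprt x - pprt (- x)) = blinfun_apply g (pprt x - pprt (- x))"
      by (simp add: blinfun.diff_right)
    then show "blinfun_apply f x = blinfun_apply g x"
      by (simp only: prt_diff[of x, symmetric])
  qed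
  show add: "f \<le> g \<Longrightarrow> k + f \<le> k + g" by (simp add: simps)
  show "r *\<^sub>R f \<le> r *\<^sub>R g" if "f \<le> g" "0 \<le> r"
    using that by (auto simp: simps intro: scaleR_left_mono)
  show "r *\<^sub>R f \<le> s *\<^sub>R f" if "r \<le> s" "0 \<le> f"
    using that by (auto simp: simps intro: scaleR_right_mono)
  show "f \<le> sup f g" using pos_nonneg[of "g - f"] by (simp add: sup_blinfun_def simps)
  show "g \<le> sup f g" using pos_ub[of "g - f"] by (simp add: sup_blinfun_def simps algebra_simps)
  show "sup g k \<le> f" if "g \<le> f" "k \<le> f"
    using pos_least[of "k - g" "f - g"] that
    by (simp add: sup_blinfun_def simps algebra_simps)
  show "inf f g \<le> f" using pos_nonneg[of "f - g"] by (simp add: inf_blinfun_def simps)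
  show "inf f g \<le> g" using pos_ub[of "f - g"] by (simp add: inf_blinfun_def simps algebra_simps)
  show "f \<le> inf g k" if "f \<le> g" "f \<le> k"
    using pos_least[of "g - k" "g - f"] that
    by (simp add: inf_blinfun_def simps algebra_simps)
  show "\<bar>f\<bar> = sup f (- f)" by (rule abs_blinfun_def)
  have abs_ub: "blinfun_apply h x \<le> blinfun_apply \<bar>h\<bar> x" 
    and abs_ub': "- blinfun_apply h x \<le> blinfun_apply \<bar>h\<bar> x" if "0 \<le> x" 
    for h :: "'a \<Rightarrow>\<^sub>L 'b" and x
    using pos_nonneg[of "- h - h"] pos_ub[of "- h - h"] that
    by (auto simp: abs_blinfun_def sup_blinfun_def simps algebra_simps)
  show "norm f \<le> norm g" if le: "\<bar>f\<bar> \<le> \<bar>g\<bar>"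
  proof (rule norm_blinfun_bound)
    fix x
    have fx: "\<bar>blinfun_apply f x\<bar> \<le> blinfun_apply \<bar>f\<bar> \<bar>x\<bar>"
    proof -
      have eq: "blinfun_apply f x = blinfun_apply f (pprt x) - blinfun_apply f (pprt (- x))"
        by (simp only: blinfun.diff_right[symmetric] prt_diff[of x, symmetric])
      show ?thesis
        unfolding eq abs_prt_sum[of x] blinfun.add_right
        using add_mono[OF abs_ub[of "pprt x" f] abs_ub'[of "pprt (- x)" f]]
          add_mono[OF abs_ub'[of "pprt x" f] abs_ub[of "pprt (- x)" f]]
        by (intro abs_leI) (simp_all add: algebra_simps)
    qed
    also have "\<dots> \<le> blinfun_apply \<bar>g\<bar> \<bar>x\<bar>"
      using le by (simp add: less_eq_blinfun_def)
    also have "\<dots> \<le> (norm g * norm x) *\<^sub>R 1"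
    proof -
      have "cone_part (- g - g) \<bar>x\<bar> \<le> (norm g * norm x) *\<^sub>R 1 - blinfun_apply g \<bar>x\<bar>"
      proof (rule cone_part_least)
        fix y assume y: "0 \<le> y" "y \<le> \<bar>x\<bar>"
        have "\<bar>\<bar>x\<bar> - y - y\<bar> \<le> \<bar>x\<bar>"
        proof (rule abs_leI)
          show "\<bar>x\<bar> - y - y \<le> \<bar>x\<bar>"
            using add_nonneg_nonneg[OF y(1) y(1)] by (simp add: algebra_simps)
          show "- (\<bar>x\<bar> - y - y) \<le> \<bar>x\<bar>"
            using add_mono[OF y(2) y(2)] by (simp add: algebra_simps)
        qed
        then have "blinfun_apply g (\<bar>x\<bar> - y - y) \<le> (norm g * norm x) *\<^sub>R 1"
          by (intro le_if_norm_le blinfun_norm_interval)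
        then show "blinfun_apply (- g - g) y \<le> (norm g * norm x) *\<^sub>R 1 - blinfun_apply g \<bar>x\<bar>"
          by (simp add: simps blinfun.diff_right blinfun.add_right algebra_simps)
      qed simp
      then show ?thesis
        by (simp add: abs_blinfun_def sup_blinfun_def simps pos_part_apply algebra_simps)
    qed
    finally show "norm (blinfun_apply f x) \<le> norm g * norm x"
      by (rule norm_le_if_abs_le) simp
  qed simp
qed

end


section \<open>Convergence\<close>

text \<open>
  Nets are rendered by filters on the index type, as usual in HOL; a sequence is the case
  \<open>F = sequentially\<close>.
\<close>

text \<open>
  A net indexed by a set \<open>B\<close>, directed upwards by the preorder \<open>r\<close>, which decreases to \<open>0\<close>.
\<close>

definition net_decreasing_to_0 ::
    "'i set \<Rightarrow> ('i \<Rightarrow> 'i \<Rightarrow> bool) \<Rightarrow> ('i \<Rightarrow> 'g::banach_lattice) \<Rightarrow> bool" where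
  "net_decreasing_to_0 B r y \<longleftrightarrow>
     B \<noteq> {} \<and> reflp_on B r \<and> transp_on B r \<and> (\<forall>i\<in>B. \<forall>j\<in>B. \<exists>k\<in>B. r i k \<and> r j k) \<and>
     (\<forall>i\<in>B. \<forall>j\<in>B. r i j \<longrightarrow> y j \<le> y i) \<and>
     (\<forall>i\<in>B. 0 \<le> y i) \<and> (\<forall>z. (\<forall>i\<in>B. z \<le> y i) \<longrightarrow> z \<le> 0)"

text \<open>
  HOL cannot quantify over the index type of the dominating net inside a definition. Index sets
  in \<open>'g\<close> suffice: if \<open>y\<close> is a net decreasing to \<open>0\<close> over any index type, then its range with
  the reversed order is a directed set and the identity on it is a dominating net as good as \<open>y\<close>.
\<close>

definition order_tendsto :: "('i \<Rightarrow> 'g::banach_lattice) \<Rightarrow> 'g \<Rightarrow> 'i filter \<Rightarrow> bool" where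
  "order_tendsto x l F \<longleftrightarrow>
     (\<exists>(B::'g set) r y. net_decreasing_to_0 B r y \<and>
        (\<forall>\<beta>\<in>B. \<forall>\<^sub>F \<alpha> in F. \<bar>x \<alpha> - l\<bar> \<le> y \<beta>))"

definition weak_tendsto :: "('i \<Rightarrow> 'g::real_normed_vector) \<Rightarrow> 'g \<Rightarrow> 'i filter \<Rightarrow> bool" where
  "weak_tendsto x l F \<longleftrightarrow>
     (\<forall>\<phi> :: 'g \<Rightarrow>\<^sub>L real. ((\<lambda>\<alpha>. blinfun_apply \<phi> (x \<alpha>)) \<longlongrightarrow> blinfun_apply \<phi> l) F)"

definition weak_star_tendsto ::
    "('i \<Rightarrow> 'e::real_normed_vector \<Rightarrow>\<^sub>L real) \<Rightarrow> ('e \<Rightarrow>\<^sub>L real) \<Rightarrow> 'i filter \<Rightarrow> bool" where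
  "weak_star_tendsto x l F \<longleftrightarrow>
     (\<forall>e. ((\<lambda>\<alpha>. blinfun_apply (x \<alpha>) e) \<longlongrightarrow> blinfun_apply l e) F)"

definition uo_tendsto :: "('i \<Rightarrow> 'g::banach_lattice) \<Rightarrow> 'g \<Rightarrow> 'i filter \<Rightarrow> bool" where
  "uo_tendsto x l F \<longleftrightarrow> (\<forall>u\<ge>0. order_tendsto (\<lambda>\<alpha>. inf \<bar>x \<alpha> - l\<bar> u) 0 F)"

definition uaw_tendsto :: "('i \<Rightarrow> 'g::banach_lattice) \<Rightarrow> 'g \<Rightarrow> 'i filter \<Rightarrow> bool" where
  "uaw_tendsto x l F \<longleftrightarrow> (\<forall>u\<ge>0. weak_tendsto (\<lambda>\<alpha>. inf \<bar>x \<alpha> - l\<bar> u) 0 F)"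

definition uaw_star_tendsto ::
    "('i \<Rightarrow> 'e::banach_lattice \<Rightarrow>\<^sub>L real) \<Rightarrow> ('e \<Rightarrow>\<^sub>L real) \<Rightarrow> 'i filter \<Rightarrow> bool" where
  "uaw_star_tendsto x l F \<longleftrightarrow> (\<forall>u\<ge>0. weak_star_tendsto (\<lambda>\<alpha>. inf \<bar>x \<alpha> - l\<bar> u) 0 F)"

abbreviation uo_null :: "(nat \<Rightarrow> 'g::banach_lattice) \<Rightarrow> bool" where
  "uo_null x \<equiv> uo_tendsto x 0 sequentially"

abbreviation uaw_null :: "(nat \<Rightarrow> 'g::banach_lattice) \<Rightarrow> bool" where
  "uaw_null x \<equiv> uaw_tendsto x 0 sequentially"

abbreviation uaw_star_null :: "(nat \<Rightarrow> 'e::banach_lattice \<Rightarrow>\<^sub>L real) \<Rightarrow> bool" where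
  "uaw_star_null x \<equiv> uaw_star_tendsto x 0 sequentially"


section \<open>L-weakly compact sets\<close>

definition solid :: "'g::banach_lattice set \<Rightarrow> bool" where
  "solid S \<longleftrightarrow> (\<forall>x\<in>S. \<forall>y. \<bar>y\<bar> \<le> \<bar>x\<bar> \<longrightarrow> y \<in> S)"

lemma solid_hull_eq: "solid hull A = {y. \<exists>x\<in>A. \<bar>y\<bar> \<le> \<bar>x\<bar>}"
proof (rule hull_unique)
  show "solid {y. \<exists>x\<in>A. \<bar>y\<bar> \<le> \<bar>x\<bar>}"
    unfolding solid_def by (blast intro: order_trans)
qed (auto simp: solid_def)

definition disjoint_seq :: "(nat \<Rightarrow> 'g::banach_lattice) \<Rightarrow> bool" where
  "disjoint_seq x \<longleftrightarrow> (\<forall>n m. n \<noteq> m \<longrightarrow> inf \<bar>x n\<bar> \<bar>x m\<bar> = 0)"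

definition L_weakly_compact :: "'g::banach_lattice set \<Rightarrow> bool" where
  "L_weakly_compact A \<longleftrightarrow>
     bounded A \<and> (\<forall>x. disjoint_seq x \<and> range x \<subseteq> solid hull A \<longrightarrow> x \<longlonglongrightarrow> 0)"

end

theory Submission
  imports Defs
begin

text \<open>
  Everything rests on two extraction arguments. For a monotone subadditive function \<open>\<rho>\<close> dominated by
  the norm and a bounded set \<open>X\<close> of positive vectors, either some \<open>u\<close> generated by \<open>X\<close> makes
  \<open>\<rho> ((x - u)\<^sup>+)\<close> uniformly small on \<open>X\<close>, or there are disjoint vectors below elements of \<open>X\<close> on which
  \<open>\<rho>\<close> is bounded away from zero. Secondly, disjoint vectors and disjoint functionals can be traded:
  positive functionals restrict to the bands generated by disjoint vectors, and disjoint functionals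
  that are large at one positive \<open>a\<close> are large at disjoint vectors in the interval from \<open>0\<close> to \<open>a\<close>.

  Let \<open>A\<close> be L-weakly compact and \<open>f\<^sub>n\<close> bounded and \<open>uaw\<^sup>*\<close>-null. For fixed \<open>a \<in> A\<close> the dichotomy for
  \<open>\<rho> g = g \<bar>a\<bar>\<close> on the dual space gives \<open>\<bar>f\<^sub>n\<bar> \<bar>a\<bar> \<longlonglongrightarrow> 0\<close>, since its second alternative yields
  disjoint vectors below \<open>\<bar>a\<bar>\<close> that do not converge to zero. The dichotomy for the norm on \<open>A\<close> then
  makes the convergence uniform. Conversely, a disjoint sequence in the solid hull of \<open>A\<close> that is not
  norm null produces disjoint functionals that are not uniformly null on \<open>A\<close>, and disjoint sequences
  are null in each of the unbounded senses. Part (2) is the same with the roles of the spaces exchanged.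
\<close>

section \<open>The Hahn--Banach theorem for sublinear functions\<close>

text \<open>Homogeneity is asked only as an inequality and only for \<open>t > 0\<close>, which
  keeps verification short; \<open>sublinear_scaleR\<close> and \<open>sublinear_0\<close> recover
  equality and the value at 0.\<close>

definition sublinear :: "('a::real_vector \<Rightarrow> real) \<Rightarrow> bool" where
  "sublinear p \<longleftrightarrow>
     (\<forall>x y. p (x + y) \<le> p x + p y) \<and> (\<forall>t>0. \<forall>x. p (t *\<^sub>R x) \<le> t * p x)"

lemma sublinearI:
  assumes "\<And>x y. p (x + y) \<le> p x + p y" "\<And>t x. 0 < t \<Longrightarrow> p (t *\<^sub>R x) \<le> t * p x"
  shows "sublinear p"
  using assms by (auto simp: sublinear_def)

lemma sublinear_add: "sublinear p \<Longrightarrow> p (x + y) \<le> p x + p y"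
  by (auto simp: sublinear_def)

lemma sublinear_scaleR:
  assumes "sublinear p" "0 < t"
  shows "p (t *\<^sub>R x) = t * p x"
proof (rule antisym)
  show "p (t *\<^sub>R x) \<le> t * p x" using assms by (auto simp: sublinear_def)
  have "p (inverse t *\<^sub>R (t *\<^sub>R x)) \<le> inverse t * p (t *\<^sub>R x)"
    using assms unfolding sublinear_def by (meson positive_imp_inverse_positive)
  then show "t * p x \<le> p (t *\<^sub>R x)"
    using assms by (simp add: field_simps)
qed

lemma sublinear_0: "sublinear p \<Longrightarrow> p 0 = 0"
  using sublinear_scaleR[of p 2 0] by simp

lemma sublinear_lower: "sublinear p \<Longrightarrow> - p (- x) \<le> p x"
  using sublinear_add[of p x "- x"] sublinear_0[of p] by simp

text \<open>The values \<open>t = 0\<close> and \<open>t = 1\<close> in the infimum give the two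
  bounds. At \<open>x = - y\<close> the second reads \<open>q (- y) \<le> - p y\<close>, so every
  linear function below \<open>q\<close> takes at least the value \<open>p y\<close> at
  \<open>y\<close>.\<close>

lemma sublinear_shrink:
  fixes y :: "'a::real_vector"
  assumes p: "sublinear p"
  obtains q where "sublinear q" "\<And>x. q x \<le> p x" "\<And>x. q x \<le> p (x + y) - p y"
proof -
  define q where "q x = (INF t\<in>{0..}. p (x + t *\<^sub>R y) - t * p y)" for x
  \<comment> \<open>A lower bound free of \<open>t\<close> makes the infimum defining
    \<open>q\<close> finite.\<close>
  have lower: "- p (- x) \<le> p (x + t *\<^sub>R y) - t * p y" if "0 \<le> t" for x t
  proof -
    have "t * p y = p (t *\<^sub>R y)"
      using that sublinear_scaleR[OF p, of t] sublinear_0[OF p] by (cases "t = 0") auto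
    also have "\<dots> \<le> p (x + t *\<^sub>R y) + p (- x)"
      using sublinear_add[OF p, of "x + t *\<^sub>R y" "- x"] by simp
    finally show ?thesis by simp
  qed
  have le: "q x \<le> p (x + t *\<^sub>R y) - t * p y" if "0 \<le> t" for x t
    unfolding q_def using that lower by (intro cINF_lower) (auto intro!: bdd_belowI2)
  have ge: "c \<le> q x" if "\<And>t. 0 \<le> t \<Longrightarrow> c \<le> p (x + t *\<^sub>R y) - t * p y" for c x
    unfolding q_def using that by (intro cINF_greatest) auto
  have "sublinear q"
  proof (rule sublinearI)
    fix x x'
    have "q (x + x') - q x \<le> q x'"
    proof (rule ge)
      fix t' :: real assume t': "0 \<le> t'"
      have "q (x + x') - (p (x' + t' *\<^sub>R y) - t' * p y) \<le> q x"
      proof (rule ge)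
        fix t :: real assume t: "0 \<le> t"
        \<comment> \<open>The parameters of the two infima are added: \<open>t + t'\<close> is
          admissible for \<open>x + x'\<close>.\<close>
        have "q (x + x') \<le> p (x + x' + (t + t') *\<^sub>R y) - (t + t') * p y"
          using t t' by (intro le) auto
        also have "\<dots> \<le> p (x + t *\<^sub>R y) + p (x' + t' *\<^sub>R y) - (t + t') * p y"
          using sublinear_add[OF p, of "x + t *\<^sub>R y" "x' + t' *\<^sub>R y"] by (simp add: algebra_simps)
        finally show "q (x + x') - (p (x' + t' *\<^sub>R y) - t' * p y) \<le> p (x + t *\<^sub>R y) - t * p y"
          by (simp add: algebra_simps)
      qed
      then show "q (x + x') - q x \<le> p (x' + t' *\<^sub>R y) - t' * p y" by simp
    qed
    then show "q (x + x') \<le> q x + q x'" by simp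
  next
    fix s :: real and x assume s: "0 < s"
    have "q (s *\<^sub>R x) / s \<le> q x"
    proof (rule ge)
      fix t :: real assume "0 \<le> t"
      then have "q (s *\<^sub>R x) \<le> p (s *\<^sub>R x + (s * t) *\<^sub>R y) - (s * t) * p y"
        using s by (intro le) auto
      also have "s *\<^sub>R x + (s * t) *\<^sub>R y = s *\<^sub>R (x + t *\<^sub>R y)" by (simp add: scaleR_add_right)
      finally show "q (s *\<^sub>R x) / s \<le> p (x + t *\<^sub>R y) - t * p y"
        using s sublinear_scaleR[OF p s, of "x + t *\<^sub>R y"] by (simp add: field_simps)
    qed
    then show "q (s *\<^sub>R x) \<le> s * q x" using s by (simp add: field_simps)
  qed
  with le[of 0] le[of 1] show ?thesis by (intro that[of q]) auto
qed

text \<open>A minimal sublinear function is unchanged by the previous construction and therefore additive.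
  Working with such functions instead of partial extensions avoids subspaces altogether.\<close>

lemma minimal_sublinear:
  fixes p :: "'a::real_vector \<Rightarrow> real"
  assumes p: "sublinear p"
  obtains m where "sublinear m" "m \<le> p" "\<forall>q. sublinear q \<longrightarrow> q \<le> m \<longrightarrow> q = m"
proof -
  define S where "S = {q. sublinear q \<and> q \<le> p}"
  \<comment> \<open>The order is reversed, so a maximal element in the sense of Zorn is a minimal
    function, and a chain is bounded by its pointwise infimum.\<close>
  have "\<exists>m\<in>S. \<forall>q\<in>S. q \<le> m \<longrightarrow> q = m"
  proof (rule predicate_Zorn)
    show "partial_order_on S (relation_of (\<lambda>q q'. q' \<le> q) S)"
      by (rule partial_order_on_relation_ofI) auto
  next
    fix C assume "C \<in> Chains (relation_of (\<lambda>q q'. q' \<le> q) S)"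
    then have C: "C \<subseteq> S" "\<And>q q'. q \<in> C \<Longrightarrow> q' \<in> C \<Longrightarrow> q \<le> q' \<or> q' \<le> q"
      by (auto simp: Chains_def relation_of_def)
    show "\<exists>u\<in>S. \<forall>q\<in>C. u \<le> q"
    proof (cases "C = {}")
      case True
      then show ?thesis using p by (auto simp: S_def)
    next
      case False
      define u where "u x = (INF q\<in>C. q x)" for x
      have lower: "- p (- x) \<le> q x" if "q \<in> C" for q x
        proof -
        have "sublinear q" "q (- x) \<le> p (- x)" using that C(1) by (auto simp: S_def le_fun_def)
        with sublinear_lower[of q x] show ?thesis by linarith
      qed
      have le: "u x \<le> q x" if "q \<in> C" for q x
        unfolding u_def using that lower[of _ x] by (intro cINF_lower) (auto intro!: bdd_belowI2)
      have ge: "c \<le> u x" if "\<And>q. q \<in> C \<Longrightarrow> c \<le> q x" for c x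
        unfolding u_def using that False by (intro cINF_greatest) auto
      have "sublinear u"
      proof (rule sublinearI)
        fix x y
        \<comment> \<open>In a chain, \<open>q\<close> and \<open>q'\<close> have a common lower
          member, whose subadditivity handles both arguments at once.\<close>
        have add: "u (x + y) \<le> q x + q' y" if q: "q \<in> C" "q' \<in> C" for q q'
        proof -
          obtain r where r: "r \<in> C" "r \<le> q" "r \<le> q'" using C(2)[OF q] q by auto
          have "u (x + y) \<le> r x + r y"
            using le[OF r(1), of "x + y"] sublinear_add[of r x y] C(1) r(1) by (auto simp: S_def)
          then show ?thesis using r(2,3) by (meson add_mono le_funD order_trans)
        qed
        have "u (x + y) - u x \<le> u y"
        proof (rule ge)
          fix q' assume q': "q' \<in> C"
          have "u (x + y) - q' y \<le> u x"
            by (rule ge) (use add q' in \<open>simp add: algebra_simps\<close>)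
          then show "u (x + y) - u x \<le> q' y" by simp
        qed
        then show "u (x + y) \<le> u x + u y" by simp
      next
        fix t :: real and x assume t: "0 < t"
        have "u (t *\<^sub>R x) / t \<le> u x"
        proof (rule ge)
          fix q assume q: "q \<in> C"
          then have "q (t *\<^sub>R x) = t * q x" using C(1) t by (auto simp: S_def sublinear_scaleR)
          then show "u (t *\<^sub>R x) / t \<le> q x" using le[OF q, of "t *\<^sub>R x"] t by (simp add: field_simps)
        qed
        then show "u (t *\<^sub>R x) \<le> t * u x" using t by (simp add: field_simps)
      qed
      moreover obtain q0 where "q0 \<in> C" using False by blast
      then have "u \<le> p" using C(1) le[of q0] unfolding S_def le_fun_def by (blast intro: order_trans)
      ultimately show ?thesis using le by (auto simp: S_def le_fun_def)
    qed
  qed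
  then obtain m where m: "m \<in> S" "\<And>q. q \<in> S \<Longrightarrow> q \<le> m \<Longrightarrow> q = m" by blast
  show ?thesis
  proof (rule that)
    show "sublinear m" "m \<le> p" using m(1) by (auto simp: S_def)
    show "\<forall>q. sublinear q \<longrightarrow> q \<le> m \<longrightarrow> q = m"
    proof (intro allI impI)
      fix q assume q: "sublinear q" "q \<le> m"
      have "q \<le> p" using q(2) m(1) unfolding S_def by (blast intro: order_trans)
      then show "q = m" using q m(2) by (simp add: S_def)
    qed
  qed
qed

lemma minimal_sublinear_linear:
  assumes m: "sublinear m" and min: "\<And>q. sublinear q \<Longrightarrow> q \<le> m \<Longrightarrow> q = m"
  shows "linear m"
proof -
  have add: "m (x + y) = m x + m y" for x y
  proof (rule antisym)
    show "m (x + y) \<le> m x + m y" by (rule sublinear_add[OF m])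
    obtain q where q: "sublinear q" "\<And>x. q x \<le> m x" "\<And>x. q x \<le> m (x + y) - m y"
      using sublinear_shrink[OF m, of y] by blast
    have "q = m" by (rule min[OF q(1)]) (simp add: le_fun_def q(2))
    with q(3)[of x] have "m x \<le> m (x + y) - m y" by (simp only:)
    then show "m x + m y \<le> m (x + y)" by linarith
  qed
  have neg: "m (- x) = - m x" for x
    using add[of x "- x"] sublinear_0[OF m] by simp
  have "m (r *\<^sub>R x) = r * m x" for r x
  proof (cases r "0::real" rule: linorder_cases)
    case less
    then show ?thesis using sublinear_scaleR[OF m, of "- r" x] neg[of "r *\<^sub>R x"] by simp
  qed (use sublinear_scaleR[OF m] sublinear_0[OF m] in auto)
  then show ?thesis using add by (intro linearI) auto
qed

text \<open>Shrinking at \<open>a\<close> before minimizing forces the value there: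
  \<open>m (- a) \<le> q (- a) \<le> - p a\<close>, so the linear \<open>m\<close> satisfies
  \<open>p a \<le> m a\<close>. The norm bound on \<open>p\<close> makes \<open>m\<close>
  continuous.\<close>

theorem Hahn_Banach_sublinear:
  fixes p :: "'a::real_normed_vector \<Rightarrow> real"
  assumes p: "sublinear p" and bound: "\<And>x. p x \<le> C * norm x"
  obtains f :: "'a \<Rightarrow>\<^sub>L real" where "\<And>x. f x \<le> p x" "f a = p a"
proof -
  obtain q where q: "sublinear q" "\<And>x. q x \<le> p x" "\<And>x. q x \<le> p (x + a) - p a"
    using sublinear_shrink[OF p, of a] by blast
  obtain m where m: "sublinear m" "m \<le> q" "\<forall>q. sublinear q \<longrightarrow> q \<le> m \<longrightarrow> q = m"
    by (rule minimal_sublinear[OF q(1)])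
  have lin: "linear m" by (rule minimal_sublinear_linear[OF m(1)]) (use m(3) in blast)
  have mp: "m x \<le> p x" for x using le_funD[OF m(2), of x] q(2)[of x] by linarith
  have "bounded_linear m"
  proof (rule bounded_linear.intro[OF lin], unfold_locales, intro exI allI)
    fix x
    show "norm (m x) \<le> norm x * C"
      using mp[of x] mp[of "- x"] bound[of x] bound[of "- x"] linear_neg[OF lin, of x]
      by (simp add: mult.commute)
  qed
  then have [simp]: "blinfun_apply (Blinfun m) = m" by (rule bounded_linear_Blinfun_apply)
  have "- m a \<le> - p a"
    using le_funD[OF m(2), of "- a"] q(3)[of "- a"] linear_neg[OF lin, of a] sublinear_0[OF p]
    by simp
  then have "m a = p a" using mp[of a] by simp
  then show ?thesis using that[of "Blinfun m"] mp by simp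
qed

section \<open>Extracting disjoint vectors\<close>

lemma diff_inf_eq_pprt:
  fixes a b :: "'a::banach_lattice"
  shows "a - inf a b = pprt (a - b)"
  unfolding pprt_def diff_inf_eq_sup add_sup_distrib_left by (simp add: sup_commute)

lemma pprt_le_self_add:
  fixes a b :: "'a::banach_lattice"
  assumes "0 \<le> b"
  shows "pprt a \<le> pprt (a - b) + b"
  using assms by (simp add: pprt_def add_sup_distrib_right le_supI2 le_supI1)

lemma pprt_diff_le:
  fixes a b :: "'a::banach_lattice"
  assumes "0 \<le> a" "0 \<le> b"
  shows "pprt (a - b) \<le> a"
  using assms by (simp add: pprt_def)

lemma scaleR_inf:
  fixes x y :: "'a::banach_lattice"
  assumes "0 < c"
  shows "c *\<^sub>R inf x y = inf (c *\<^sub>R x) (c *\<^sub>R y)"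
proof (rule antisym)
  show "c *\<^sub>R inf x y \<le> inf (c *\<^sub>R x) (c *\<^sub>R y)"
    using assms by (simp add: scaleR_le_cancel_left_pos)
  have "inverse c *\<^sub>R inf (c *\<^sub>R x) (c *\<^sub>R y) \<le> inf x y"
  proof (rule le_infI)
    have "inverse c *\<^sub>R inf (c *\<^sub>R x) (c *\<^sub>R y) \<le> inverse c *\<^sub>R (c *\<^sub>R x)"
      using assms by (intro scaleR_left_mono) auto
    then show "inverse c *\<^sub>R inf (c *\<^sub>R x) (c *\<^sub>R y) \<le> x" using assms by simp
    have "inverse c *\<^sub>R inf (c *\<^sub>R x) (c *\<^sub>R y) \<le> inverse c *\<^sub>R (c *\<^sub>R y)"
      using assms by (intro scaleR_left_mono) auto
    then show "inverse c *\<^sub>R inf (c *\<^sub>R x) (c *\<^sub>R y) \<le> y" using assms by simp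
  qed
  then have "c *\<^sub>R (inverse c *\<^sub>R inf (c *\<^sub>R x) (c *\<^sub>R y)) \<le> c *\<^sub>R inf x y"
    using assms by (simp only: scaleR_le_cancel_left_pos)
  then show "inf (c *\<^sub>R x) (c *\<^sub>R y) \<le> c *\<^sub>R inf x y" using assms by simp
qed

lemma inf_add_le:
  fixes a b c :: "'a::banach_lattice"
  assumes "0 \<le> a" "0 \<le> b" "0 \<le> c"
  shows "inf (a + b) c \<le> inf a c + inf b c"
proof -
  have "inf (a + b) c - inf b c \<le> inf a c"
  proof (rule le_infI)
    have "inf (a + b) c \<le> a + inf b c"
      using assms by (simp add: add_inf_distrib_left le_infI2 add_increasing)
    then show "inf (a + b) c - inf b c \<le> a" by (simp only: diff_le_eq)
    have "inf (a + b) c \<le> c + inf b c"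
      using assms by (intro le_infI2) (simp add: add_increasing2)
    then show "inf (a + b) c - inf b c \<le> c" by (simp only: diff_le_eq)
  qed
  then show ?thesis by (simp only: diff_le_eq)
qed

lemma inf_eq_0_mono:
  fixes a b c d :: "'a::banach_lattice"
  assumes "inf a b = 0" "0 \<le> c" "c \<le> a" "0 \<le> d" "d \<le> b"
  shows "inf c d = 0"
  using inf_mono[OF assms(3,5)] assms(1,2,4) by (simp add: antisym)

lemma inf_scaleR_eq_0:
  fixes a b :: "'a::banach_lattice"
  assumes "inf a b = 0" "0 \<le> a" "0 \<le> b" "0 < c"
  shows "inf a (c *\<^sub>R b) = 0"
proof -
  \<comment> \<open>Since \<open>d\<close> is at least 1 and at least \<open>c\<close>, both vectors
    lie below the \<open>d\<close>-fold multiples of \<open>a\<close> and \<open>b\<close>, which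
    remain disjoint.\<close>
  define d where "d = max 1 c"
  have "inf (d *\<^sub>R a) (d *\<^sub>R b) = 0"
    using scaleR_inf[of d a b] assms(1) by (simp add: d_def)
  moreover have "1 *\<^sub>R a \<le> d *\<^sub>R a" "c *\<^sub>R b \<le> d *\<^sub>R b"
    using assms by (intro scaleR_right_mono; simp add: d_def)+
  ultimately show ?thesis
    using assms by (auto intro!: scaleR_nonneg_nonneg elim!: inf_eq_0_mono)
qed

lemma inf_pprt_pprt_uminus:
  fixes x :: "'a::banach_lattice"
  shows "inf (pprt x) (pprt (- x)) = 0"
proof -
  have "pprt x = x + pprt (- x)" using prt_diff[of x] by (simp only: eq_diff_eq)
  then have "inf (pprt x) (pprt (- x)) = inf x 0 + pprt (- x)"
    by (simp only: add_inf_distrib_right add_0_left)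
  also have "inf x 0 = - pprt (- x)" unfolding pprt_def neg_sup_eq_inf by simp
  finally show ?thesis by simp
qed

lemma scaleR_pprt:
  fixes x :: "'a::banach_lattice"
  assumes "0 < c"
  shows "c *\<^sub>R pprt x = pprt (c *\<^sub>R x)"
proof -
  have "pprt y = - inf (- y) 0" for y :: 'a
    unfolding pprt_def neg_inf_eq_sup by simp
  moreover have "c *\<^sub>R (- inf (- x) 0) = - inf (- (c *\<^sub>R x)) 0"
    unfolding scaleR_minus_right scaleR_inf[OF assms] by simp
  ultimately show ?thesis by metis
qed

text \<open>The second difference is a negative multiple of the first, so the two positive parts are
  the positive part and a rescaled negative part of one vector. This is the source of all disjoint
  vectors constructed below.\<close>

lemma inf_pprt_diff_scaleR:
  fixes a b :: "'a::banach_lattice"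
  assumes "0 < c"
  shows "inf (pprt (a - c *\<^sub>R b)) (pprt (b - inverse c *\<^sub>R a)) = 0"
proof -
  have "inverse c *\<^sub>R (- (a - c *\<^sub>R b)) = b - inverse c *\<^sub>R a"
    using assms by (simp add: scaleR_diff_right)
  then have "pprt (b - inverse c *\<^sub>R a) = inverse c *\<^sub>R pprt (- (a - c *\<^sub>R b))"
    using assms by (simp only: scaleR_pprt positive_imp_inverse_positive)
  then show ?thesis
    using assms by (simp only:) (intro inf_scaleR_eq_0 inf_pprt_pprt_uminus zero_le_pprt, simp)
qed

lemma sup_eq_add_if_disjoint:
  fixes a b :: "'a::banach_lattice"
  assumes "inf a b = 0"
  shows "sup a b = a + b"
  unfolding add_eq_inf_sup[of a b] assms by simp

lemma disjoint_seqI: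
  assumes "\<And>n. 0 \<le> x n" "\<And>m n. m < n \<Longrightarrow> inf (x m) (x n) = 0"
  shows "disjoint_seq x"
  unfolding disjoint_seq_def
proof (intro allI impI)
  fix n m :: nat assume "n \<noteq> m"
  then consider "n < m" | "m < n" by linarith
  then show "inf \<bar>x n\<bar> \<bar>x m\<bar> = 0"
  proof cases
    case 1
    then show ?thesis using assms by simp
  next
    case 2
    then show ?thesis using assms(1) assms(2)[OF 2] by (subst inf_commute) simp
  qed
qed

text \<open>The positive cone is closed because the negative part of the limit is dominated by
  \<open>\<bar>x n - l\<bar>\<close>.\<close>

lemma nonneg_lim:
  fixes x :: "nat \<Rightarrow> 'a::banach_lattice"
  assumes "\<forall>\<^sub>F n in sequentially. 0 \<le> x n" "x \<longlonglongrightarrow> l"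
  shows "0 \<le> l"
proof -
  have "norm (pprt (- l)) \<le> norm (x n - l)" if "0 \<le> x n" for n
  proof (rule norm_mono_abs)
    have "- l \<le> x n - l" using that by simp
    also have "\<dots> \<le> \<bar>x n - l\<bar>" by (rule abs_ge_self)
    finally have "pprt (- l) \<le> \<bar>x n - l\<bar>" by (simp add: pprt_def)
    then show "\<bar>pprt (- l)\<bar> \<le> \<bar>x n - l\<bar>" by (simp add: abs_of_nonneg)
  qed
  then have "\<forall>\<^sub>F n in sequentially. norm (pprt (- l)) \<le> norm (x n - l)"
    using assms(1) by (auto elim: eventually_mono)
  moreover have "(\<lambda>n. norm (x n - l)) \<longlonglongrightarrow> 0"
    using assms(2) by (simp add: LIM_zero_iff tendsto_norm_zero)
  ultimately have "norm (pprt (- l)) \<le> 0"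
    by (intro tendsto_lowerbound[of "\<lambda>n. norm (x n - l)" 0 sequentially]) auto
  then show ?thesis by (simp add: le_zero_iff_zero_pprt[symmetric])
qed

text \<open>A single \<open>w\<close> of small norm dominates a fixed positive multiple of every
  \<open>x n\<close>: it is the norm-convergent series of these multiples, whose terms are
  positive.\<close>

lemma sum_scaleR_geometric_bound:
  fixes x :: "nat \<Rightarrow> 'a::banach_lattice"
  assumes nonneg: "\<And>n. 0 \<le> x n" and bound: "\<And>n. norm (x n) \<le> M" and "0 < \<eta>"
  obtains w where "norm w \<le> 2 * \<eta> * M" "\<And>n. (\<eta> / 2 ^ n) *\<^sub>R x n \<le> w"
proof -
  define t where "t n = (\<eta> / 2 ^ n) *\<^sub>R x n" for n
  have norm_t: "norm (t n) \<le> \<eta> * M * (1 / 2) ^ n" for n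
    using bound[of n] \<open>0 < \<eta>\<close> by (simp add: t_def field_simps)
  have geo: "(\<lambda>n. \<eta> * M * (1 / 2) ^ n) sums (\<eta> * M * 2)"
    using sums_mult[OF geometric_sums[of "1/2 :: real"], of "\<eta> * M"] by simp
  have sum: "summable (\<lambda>n. norm (t n))"
    by (rule summable_comparison_test[OF _ sums_summable[OF geo]]) (use norm_t in auto)
  have "norm (suminf t) \<le> (\<Sum>n. norm (t n))" by (rule summable_norm[OF sum])
  also have "\<dots> \<le> (\<Sum>n. \<eta> * M * (1 / 2) ^ n)"
    by (rule suminf_le[OF norm_t sum sums_summable[OF geo]])
  also have "\<dots> = 2 * \<eta> * M" using sums_unique[OF geo] by simp
  finally have 1: "norm (suminf t) \<le> 2 * \<eta> * M" .
  have "t n \<le> suminf t" for n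
  proof -
    have lim: "(\<lambda>k. sum t {..<k}) \<longlonglongrightarrow> suminf t"
      using summable_LIMSEQ[OF summable_norm_cancel[OF sum]] .
    have "\<forall>\<^sub>F k in sequentially. 0 \<le> sum t {..<k} - t n"
    proof (rule eventually_sequentiallyI)
      fix k assume "Suc n \<le> k"
      then have "sum t {..<k} - t n = sum t ({..<k} - {n})" by (simp add: sum_diff1)
      also have "0 \<le> \<dots>"
        using nonneg \<open>0 < \<eta>\<close> by (intro sum_nonneg) (auto simp: t_def intro: scaleR_nonneg_nonneg)
      finally show "0 \<le> sum t {..<k} - t n" by simp
    qed
    from nonneg_lim[OF this tendsto_diff[OF lim tendsto_const]] show ?thesis by simp
  qed
  then show ?thesis using 1 that[of "suminf t"] by (simp add: t_def)
qed

text \<open>The vectors are \<open>v\<^sub>n = (x\<^sub>n\<^sub>+\<^sub>1 - K\<^sub>n (x\<^sub>0 + \<dots> + x\<^sub>n) - w)\<^sup>+\<close> with \<open>K\<^sub>n = 2\<^sup>n\<^sup>+\<^sup>1 / \<eta>\<close>: subtracting earlier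
  members with weight \<open>K\<^sub>n\<close> and later ones, through \<open>w\<close>, with weight at least \<open>1 / K\<^sub>n\<close> makes them disjoint.\<close>

lemma disjoint_splitting:
  fixes X U :: "'a::banach_lattice set" and \<rho> :: "'a \<Rightarrow> real"
  assumes X: "\<And>x. x \<in> X \<Longrightarrow> 0 \<le> x" "\<And>x. x \<in> X \<Longrightarrow> norm x \<le> M"
    and U: "0 \<in> U" "\<And>u x. u \<in> U \<Longrightarrow> x \<in> X \<Longrightarrow> u + x \<in> U"
      "\<And>u c. u \<in> U \<Longrightarrow> 0 \<le> c \<Longrightarrow> c *\<^sub>R u \<in> U"
    and mono: "\<And>x y. 0 \<le> x \<Longrightarrow> x \<le> y \<Longrightarrow> \<rho> x \<le> \<rho> y"
    and subadd: "\<And>x y. 0 \<le> x \<Longrightarrow> 0 \<le> y \<Longrightarrow> \<rho> (x + y) \<le> \<rho> x + \<rho> y"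
    and bound: "\<And>x. 0 \<le> x \<Longrightarrow> \<rho> x \<le> C * norm x"
    and "0 < \<delta>"
    and large: "\<And>u. u \<in> U \<Longrightarrow> \<exists>x\<in>X. \<delta> < \<rho> (pprt (x - u))"
  obtains v where "disjoint_seq v" "\<And>n. 0 \<le> v n" "\<And>n. \<exists>x\<in>X. v n \<le> x" "\<And>n. \<delta> / 2 < \<rho> (v n)"
proof -
  \<comment> \<open>\<open>D\<close> is a positive majorant of \<open>\<bar>C\<bar> * M\<close>
    whatever the signs of \<open>C\<close> and \<open>M\<close>; \<open>\<eta>\<close> is then
    chosen so that \<open>\<rho> w\<close> costs less than half of \<open>\<delta>\<close>.\<close>
  define D where "D = (\<bar>C\<bar> + 1) * (\<bar>M\<bar> + 1)"
  have D: "0 < D" unfolding D_def by (intro mult_pos_pos) auto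
  define \<eta> where "\<eta> = \<delta> / (8 * D)"
  have \<eta>: "0 < \<eta>" using \<open>0 < \<delta>\<close> D by (simp add: \<eta>_def)
  have \<eta>_small: "\<bar>C\<bar> * (2 * \<eta> * M) < \<delta> / 2"
  proof -
    have "\<bar>C\<bar> * M \<le> \<bar>C\<bar> * (\<bar>M\<bar> + 1)" by (intro mult_left_mono) auto
    also have "\<dots> \<le> (\<bar>C\<bar> + 1) * (\<bar>M\<bar> + 1)" by (intro mult_right_mono) auto
    finally have "\<bar>C\<bar> * M \<le> D" unfolding D_def .
    then have "2 * \<eta> * (\<bar>C\<bar> * M) \<le> 2 * \<eta> * D"
      using \<eta> by (intro mult_left_mono) auto
    also have "\<dots> = \<delta> / 4"
      using D by (simp add: \<eta>_def)
    finally show ?thesis using \<open>0 < \<delta>\<close> by (simp add: algebra_simps)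
  qed
  \<comment> \<open>A state is the latest member of \<open>X\<close> paired with the sum of all
    members chosen so far. The next member comes from \<open>large\<close>, applied to a multiple of
    that sum.\<close>
  have "\<exists>f. \<forall>n. (fst (f n) \<in> X \<and> snd (f n) \<in> U \<and> fst (f n) \<le> snd (f n)) \<and>
      (snd (f (Suc n)) = snd (f n) + fst (f (Suc n)) \<and>
       \<delta> < \<rho> (pprt (fst (f (Suc n)) - (2 ^ Suc n / \<eta>) *\<^sub>R snd (f n))))"
  proof (rule dependent_nat_choice)
    obtain x where "x \<in> X" using large[OF U(1)] by blast
    then show "\<exists>s. fst s \<in> X \<and> snd s \<in> U \<and> fst s \<le> snd s"
      using U(2)[OF U(1), of x] by (intro exI[of _ "(x, x)"]) auto
  next
    fix s :: "'a \<times> 'a" and n :: nat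
    assume s: "fst s \<in> X \<and> snd s \<in> U \<and> fst s \<le> snd s"
    have "(2 ^ Suc n / \<eta>) *\<^sub>R snd s \<in> U" using s \<eta> by (intro U) auto
    from large[OF this] obtain x where x: "x \<in> X"
      "\<delta> < \<rho> (pprt (x - (2 ^ Suc n / \<eta>) *\<^sub>R snd s))" by blast
    have "0 \<le> snd s" using s X(1) order_trans by blast
    then show "\<exists>t. (fst t \<in> X \<and> snd t \<in> U \<and> fst t \<le> snd t) \<and>
        snd t = snd s + fst t \<and> \<delta> < \<rho> (pprt (fst t - (2 ^ Suc n / \<eta>) *\<^sub>R snd s))"
      using x s U(2) by (intro exI[of _ "(x, snd s + x)"]) auto
  qed
  then obtain f where f: "\<And>n. fst (f n) \<in> X" "\<And>n. snd (f n) \<in> U" "\<And>n. fst (f n) \<le> snd (f n)"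
      "\<And>n. snd (f (Suc n)) = snd (f n) + fst (f (Suc n))"
      "\<And>n. \<delta> < \<rho> (pprt (fst (f (Suc n)) - (2 ^ Suc n / \<eta>) *\<^sub>R snd (f n)))"
    by metis
  define x s where "x n = fst (f n)" and "s n = snd (f n)" for n
  have x: "x n \<in> X" "0 \<le> x n" "norm (x n) \<le> M" for n
    using f(1) X by (auto simp: x_def)
  have s_mono: "s m \<le> s n" if "m \<le> n" for m n
    using lift_Suc_mono_le[of s, OF _ that] f(4) x(2) by (simp add: s_def x_def)
  have x_le_s: "x m \<le> s n" if "m \<le> n" for m n
    using s_mono[OF that] f(3)[of m] by (auto simp: x_def s_def intro: order_trans)
  obtain w where w: "norm w \<le> 2 * \<eta> * M" "\<And>n. (\<eta> / 2 ^ n) *\<^sub>R x n \<le> w"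
    using sum_scaleR_geometric_bound[of x M \<eta>] x \<eta> by blast
  have w0: "0 \<le> w"
    using w(2)[of 0] \<eta> scaleR_nonneg_nonneg[OF _ x(2), of "\<eta> / 2 ^ 0" 0]
    by (meson order_trans less_imp_le divide_pos_pos zero_less_numeral zero_less_power)
  define z where "z n = x (Suc n) - (2 ^ Suc n / \<eta>) *\<^sub>R s n" for n
  define v where "v n = pprt (z n - w)" for n
  have s0: "0 \<le> s n" for n using x_le_s[of 0 n] x(2)[of 0] by (auto intro: order_trans)
  have "disjoint_seq v"
  proof (rule disjoint_seqI)
    fix m n :: nat assume "m < n"
    \<comment> \<open>For this factor \<open>c\<close>, \<open>s n\<close> dominates
      \<open>x (Suc m)\<close> because \<open>Suc m \<le> n\<close>, and \<open>w\<close> dominates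
      \<open>x (Suc n)\<close> divided by \<open>c\<close>. Hence \<open>v n\<close> and
      \<open>v m\<close> lie below the two disjoint parts of
      \<open>inf_pprt_diff_scaleR\<close>.\<close>
    let ?c = "2 ^ Suc n / \<eta>"
    have c: "0 < ?c" using \<eta> by simp
    have "?c *\<^sub>R x (Suc m) \<le> ?c *\<^sub>R s n"
      using \<open>m < n\<close> \<eta> by (intro scaleR_left_mono x_le_s) auto
    then have vn: "v n \<le> pprt (x (Suc n) - ?c *\<^sub>R x (Suc m))"
      unfolding v_def z_def using w0
      by (intro pprt_mono) (simp add: algebra_simps add_increasing)
    have "v m \<le> pprt (x (Suc m) - inverse ?c *\<^sub>R x (Suc n))"
      unfolding v_def z_def using w(2)[of "Suc n"] scaleR_nonneg_nonneg[OF _ s0[of m], of "2 ^ Suc m / \<eta>"] \<eta>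
      by (intro pprt_mono) (simp add: algebra_simps add_increasing2)
    with vn inf_pprt_diff_scaleR[OF c, of "x (Suc n)" "x (Suc m)"]
    show "inf (v m) (v n) = 0"
      by (subst inf_commute) (auto intro: inf_eq_0_mono simp: v_def)
  qed (simp add: v_def)
  moreover have "v n \<le> x (Suc n)" for n
    unfolding v_def z_def using x(2)[of "Suc n"] w0 scaleR_nonneg_nonneg[OF _ s0[of n], of "2 ^ Suc n / \<eta>"] \<eta>
    by (simp add: pprt_def algebra_simps add_increasing)
  moreover have "\<delta> / 2 < \<rho> (v n)" for n
  proof -
    have "\<delta> < \<rho> (pprt (z n))" using f(5)[of n] by (simp add: z_def x_def s_def)
    also have "\<dots> \<le> \<rho> (v n + w)"
      unfolding v_def using w0 by (intro mono pprt_le_self_add) auto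
    also have "\<dots> \<le> \<rho> (v n) + \<rho> w" using w0 by (intro subadd) (auto simp: v_def)
    also have "\<rho> w \<le> C * norm w" by (rule bound[OF w0])
    also have "\<dots> \<le> \<bar>C\<bar> * (2 * \<eta> * M)" using w(1) by (intro mult_mono) auto
    finally show ?thesis using \<eta>_small by simp
  qed
  ultimately show ?thesis using x(1) by (intro that[of v]) (auto simp: v_def)
qed

section \<open>Disjoint functionals\<close>

lemma blinfun_nonneg: "0 \<le> f \<Longrightarrow> 0 \<le> x \<Longrightarrow> 0 \<le> blinfun_apply f x"
  for f :: "'a::banach_lattice \<Rightarrow>\<^sub>L real"
  by (simp add: less_eq_blinfun_def)

lemma blinfun_mono:
  fixes f :: "'a::banach_lattice \<Rightarrow>\<^sub>L real"
  assumes "0 \<le> f" "x \<le> y"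
  shows "blinfun_apply f x \<le> blinfun_apply f y"
  using blinfun_nonneg[OF assms(1), of "y - x"] assms(2) by (simp add: blinfun.diff_right)

lemma blinfun_le_apply: "f \<le> g \<Longrightarrow> 0 \<le> x \<Longrightarrow> blinfun_apply f x \<le> blinfun_apply g x"
  for f g :: "'a::banach_lattice \<Rightarrow>\<^sub>L real"
  by (simp add: less_eq_blinfun_def)

lemma blinfun_apply_le_norm: "norm f \<le> C \<Longrightarrow> blinfun_apply f x \<le> C * norm x"
  for f :: "'a::banach_lattice \<Rightarrow>\<^sub>L real"
  using norm_blinfun[of f x] mult_right_mono[of "norm f" C "norm x"] by simp

lemma abs_blinfun_apply_le:
  fixes f :: "'a::banach_lattice \<Rightarrow>\<^sub>L real"
  shows "\<bar>blinfun_apply f x\<bar> \<le> blinfun_apply \<bar>f\<bar> \<bar>x\<bar>"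
proof -
  have "f y \<le> \<bar>f\<bar> y" "- f y \<le> \<bar>f\<bar> y" if "0 \<le> y" for y
    using that blinfun_le_apply[OF abs_ge_self[of f]] blinfun_le_apply[OF abs_ge_minus_self[of f]]
    by (auto simp: blinfun.minus_left)
  from this[of "pprt x"] this[of "pprt (- x)"]
  have "\<bar>f (pprt x) - f (pprt (- x))\<bar> \<le> \<bar>f\<bar> (pprt x + pprt (- x))"
    by (auto simp: blinfun.add_right)
  then show ?thesis
    by (simp only: blinfun.diff_right[symmetric] prt_diff[of x, symmetric] abs_prt_sum[of x, symmetric])
qed

section \<open>Riesz-Kantorovich formulas for infimum and modulus\<close>

lemma cone_part_approx:
  fixes h :: "'a::banach_lattice \<Rightarrow>\<^sub>L real"
  assumes "0 \<le> x" "0 < \<eta>"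
  obtains y where "0 \<le> y" "y \<le> x" "cone_part h x < h y + \<eta>"
proof -
  have "cone_part h x - \<eta> < (SUP y\<in>{0..x}. h y)"
    using assms(2) by (simp add: cone_part_def)
  then show ?thesis
    using that assms(1) cone_part_bdd[of h x] by (subst (asm) less_cSUP_iff) (auto simp: algebra_simps)
qed

lemma inf_blinfun_apply:
  fixes f g :: "'a::banach_lattice \<Rightarrow>\<^sub>L real"
  assumes "0 \<le> x"
  shows "blinfun_apply (inf f g) x = f x - cone_part (f - g) x"
  using assms by (simp add: inf_blinfun_def blinfun.diff_left pos_part_apply)

text \<open>Together with \<open>inf_blinfun_le\<close> this is the Riesz-Kantorovich formula:
  \<open>inf f g\<close> at a positive \<open>x\<close> is the infimum of
  \<open>f (x - y) + g y\<close> over \<open>y\<close> between 0 and \<open>x\<close>.\<close>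

lemma inf_blinfun_approx:
  fixes f g :: "'a::banach_lattice \<Rightarrow>\<^sub>L real"
  assumes "0 \<le> x" "0 < \<eta>"
  obtains y where "0 \<le> y" "y \<le> x" "f (x - y) + g y < inf f g x + \<eta>"
proof -
  obtain y where "0 \<le> y" "y \<le> x" "cone_part (f - g) x < (f - g) y + \<eta>"
    using cone_part_approx[OF assms] .
  then show ?thesis
    using assms by (intro that[of y]) (auto simp: inf_blinfun_apply blinfun.diff_left blinfun.diff_right)
qed

lemma inf_blinfun_le:
  fixes f g :: "'a::banach_lattice \<Rightarrow>\<^sub>L real"
  assumes "0 \<le> y" "y \<le> x"
  shows "blinfun_apply (inf f g) x \<le> f (x - y) + g y"
  using cone_part_upper[OF assms, of "f - g"] order_trans[OF assms]
  by (auto simp: inf_blinfun_apply blinfun.diff_left blinfun.diff_right)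

lemma inf_blinfun_eq_0I:
  fixes f g :: "'a::banach_lattice \<Rightarrow>\<^sub>L real"
  assumes "0 \<le> f" "0 \<le> g"
    and "\<And>x \<eta>. 0 \<le> x \<Longrightarrow> 0 < \<eta> \<Longrightarrow> \<exists>y. 0 \<le> y \<and> y \<le> x \<and> f (x - y) + g y \<le> \<eta>"
  shows "inf f g = 0"
proof (rule antisym)
  show "inf f g \<le> 0"
    unfolding less_eq_blinfun_def
  proof (intro allI impI)
    fix x :: 'a assume x: "0 \<le> x"
    show "blinfun_apply (inf f g) x \<le> blinfun_apply 0 x"
    proof (rule field_le_epsilon)
      fix \<eta> :: real assume "0 < \<eta>"
      with assms(3)[OF x] obtain y where "0 \<le> y" "y \<le> x" "f (x - y) + g y \<le> \<eta>" by blast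
      then show "blinfun_apply (inf f g) x \<le> blinfun_apply 0 x + \<eta>"
        using inf_blinfun_le[of y x f g] by simp
    qed
  qed
qed (use assms in simp)

text \<open>By definition \<open>\<bar>f\<bar>\<close> is \<open>f\<close> plus the positive part of
  \<open>- f - f\<close>. If \<open>y\<close> nearly attains the latter at \<open>v\<close>, then
  \<open>w = v - y - y\<close> nearly attains \<open>\<bar>f\<bar> v\<close>.\<close>

lemma abs_blinfun_approx:
  fixes f :: "'a::banach_lattice \<Rightarrow>\<^sub>L real"
  assumes "0 \<le> v" "0 < \<eta>"
  obtains w where "\<bar>w\<bar> \<le> v" "\<bar>f\<bar> v < f w + \<eta>"
proof -
  obtain y where y: "0 \<le> y" "y \<le> v" "cone_part (- f - f) v < (- f - f) y + \<eta>"
    using cone_part_approx[OF assms] .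
  have "\<bar>v - y - y\<bar> \<le> v"
  proof (rule abs_leI)
    show "v - y - y \<le> v"
      using add_nonneg_nonneg[OF y(1) y(1)] by (simp add: algebra_simps)
    show "- (v - y - y) \<le> v"
      using add_mono[OF y(2) y(2)] by (simp add: algebra_simps)
  qed
  moreover have "\<bar>f\<bar> v < f (v - y - y) + \<eta>"
    using y(3) assms
    by (simp add: abs_blinfun_def sup_blinfun_def pos_part_apply blinfun.add_left blinfun.diff_left
        blinfun.minus_left blinfun.diff_right)
  ultimately show ?thesis by (rule that)
qed

section \<open>From disjoint functionals to disjoint vectors\<close>

lemma summand_le_sum:
  fixes f :: "'i \<Rightarrow> 'a::ordered_ab_group_add"
  assumes "finite I" "j \<in> I" "\<And>i. i \<in> I \<Longrightarrow> 0 \<le> f i"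
  shows "f j \<le> sum f I"
  using assms sum_nonneg[of "I - {j}" f] by (simp add: sum.remove[of I j])

lemma inf_sum_eq_0:
  fixes f :: "'i \<Rightarrow> 'a::banach_lattice"
  assumes "finite I" "0 \<le> g" "\<And>i. i \<in> I \<Longrightarrow> 0 \<le> f i" "\<And>i. i \<in> I \<Longrightarrow> inf (f i) g = 0"
  shows "inf (\<Sum>i\<in>I. f i) g = 0"
  using assms
proof (induction I rule: finite_induct)
  case (insert j I)
  have nonneg: "0 \<le> f j" "0 \<le> (\<Sum>i\<in>I. f i)" using insert.prems by (auto intro: sum_nonneg)
  have "inf (f j + (\<Sum>i\<in>I. f i)) g \<le> inf (f j) g + inf (\<Sum>i\<in>I. f i) g"
    by (rule inf_add_le) (use nonneg insert.prems in auto)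
  also have "\<dots> = 0" using insert by simp
  finally have "inf (f j + (\<Sum>i\<in>I. f i)) g \<le> 0" .
  moreover have "0 \<le> inf (f j + (\<Sum>i\<in>I. f i)) g" using nonneg insert.prems by simp
  ultimately have "inf (f j + (\<Sum>i\<in>I. f i)) g = 0" by (rule antisym)
  then show ?case using insert.hyps by simp
qed (simp add: inf_absorb1)

text \<open>Induction on \<open>I\<close>: the sum \<open>h\<close> of the other functionals is
  disjoint from \<open>g j\<close>, so \<open>x\<close> splits into \<open>w\<close>, where
  \<open>h\<close> is small, and \<open>x - w\<close>, where \<open>g j\<close> is small. The other
  vectors are found inside \<open>x - w\<close>; each half of \<open>\<eta>\<close> pays for one of
  the two losses.\<close>

lemma disjoint_functionals_decomposition:
  fixes g :: "'i \<Rightarrow> 'a::banach_lattice \<Rightarrow>\<^sub>L real"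
  assumes "finite I" "\<And>i. i \<in> I \<Longrightarrow> 0 \<le> g i"
    and "\<And>i j. i \<in> I \<Longrightarrow> j \<in> I \<Longrightarrow> i \<noteq> j \<Longrightarrow> inf (g i) (g j) = 0"
    and "0 \<le> x" "0 < \<eta>"
  shows "\<exists>y. (\<forall>i\<in>I. 0 \<le> y i \<and> g i x \<le> g i (y i) + \<eta>) \<and> (\<Sum>i\<in>I. y i) \<le> x"
  using assms
proof (induction I arbitrary: x \<eta> rule: finite_induct)
  case (insert j I)
  define h where "h = (\<Sum>i\<in>I. g i)"
  have "inf h (g j) = 0"
    unfolding h_def using insert.hyps insert.prems by (intro inf_sum_eq_0) auto
  then obtain w where w: "0 \<le> w" "w \<le> x" "g j (x - w) + h w < \<eta> / 2"
    using inf_blinfun_approx[of x "\<eta> / 2" "g j" h] insert.prems(3,4) by (auto simp: inf_commute)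
  have h_nonneg: "0 \<le> h" unfolding h_def using insert.prems by (intro sum_nonneg) auto
  have "\<exists>y. (\<forall>i\<in>I. 0 \<le> y i \<and> g i (x - w) \<le> g i (y i) + \<eta> / 2) \<and> (\<Sum>i\<in>I. y i) \<le> x - w"
    by (rule insert.IH) (use w insert.prems in auto)
  then obtain y where y: "\<forall>i\<in>I. 0 \<le> y i \<and> g i (x - w) \<le> g i (y i) + \<eta> / 2" "(\<Sum>i\<in>I. y i) \<le> x - w"
    by blast
  define y' where "y' = y(j := w)"
  have "(\<Sum>i\<in>insert j I. y' i) = w + (\<Sum>i\<in>I. y i)"
    using insert.hyps by (auto simp: y'_def intro!: sum.cong)
  also have "\<dots> \<le> x" using y(2) by (simp add: algebra_simps)
  finally have sum: "(\<Sum>i\<in>insert j I. y' i) \<le> x" .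
  have "0 \<le> y' i \<and> g i x \<le> g i (y' i) + \<eta>" if i: "i \<in> insert j I" for i
  proof (cases "i = j")
    case True
    then show ?thesis
      using w blinfun_nonneg[OF h_nonneg w(1)] insert.prems(4) by (simp add: y'_def blinfun.diff_right)
  next
    case False
    then have "i \<in> I" using i by simp
    have "g i \<le> h"
      unfolding h_def using insert.hyps insert.prems \<open>i \<in> I\<close> by (intro summand_le_sum) auto
    then have "g i w \<le> h w" using w(1) by (rule blinfun_le_apply)
    also have "h w < \<eta> / 2"
      using w(2,3) insert.prems(1)[of j] blinfun_nonneg[of "g j" "x - w"] by simp
    finally show ?thesis
      using y(1)[rule_format, OF \<open>i \<in> I\<close>] False by (simp add: y'_def blinfun.diff_right)
  qed
  with sum show ?case by blast
qed simp

text \<open>Among sufficiently many vectors \<open>y\<^sub>i\<close> with sum below \<open>z\<close>, each functional is small at some \<open>y\<^sub>i\<close>;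
  by the pigeonhole principle one \<open>y\<^sub>i\<close> serves infinitely many functionals, which stay large at the
  part \<open>(z - K y\<^sub>i)\<^sup>+\<close> of \<open>z\<close> disjoint from \<open>(y\<^sub>i - z / K)\<^sup>+\<close>.\<close>

lemma disjoint_functionals_step:
  fixes g :: "nat \<Rightarrow> 'a::banach_lattice \<Rightarrow>\<^sub>L real"
  assumes nonneg: "\<And>n. 0 \<le> g n" and disj: "\<And>m n. m \<noteq> n \<Longrightarrow> inf (g m) (g n) = 0"
    and bound: "\<And>n. norm (g n) \<le> C"
    and z: "0 \<le> z" and S: "infinite S" "\<And>n. n \<in> S \<Longrightarrow> \<epsilon> < g n z" and "\<epsilon>' < \<epsilon>"
  obtains n v z' S' where "0 \<le> v" "v \<le> z" "0 \<le> z'" "z' \<le> z" "inf v z' = 0" "\<epsilon>' < g n v"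
    "infinite S'" "\<forall>n\<in>S'. \<epsilon>' < g n z'"
proof -
  \<comment> \<open>Half the gap between the thresholds: \<open>g i v\<close> loses
    \<open>\<eta>\<close> in passing from \<open>z\<close> to \<open>y i\<close>, and again when
    \<open>z\<close> divided by \<open>K\<close> is subtracted.\<close>
  define \<eta> where "\<eta> = (\<epsilon> - \<epsilon>') / 2"
  have \<eta>: "0 < \<eta>" using \<open>\<epsilon>' < \<epsilon>\<close> by (simp add: \<eta>_def)
  have C: "0 \<le> C" using bound[of 0] norm_ge_zero order_trans by blast
  \<comment> \<open>Every \<open>g n\<close> is at most \<open>\<eta>\<close> at \<open>z\<close>
    divided by \<open>K\<close>; the added 1 keeps \<open>K\<close> positive when
    \<open>C * norm z\<close> vanishes.\<close>
  define K where "K = C * norm z / \<eta> + 1"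
  have K: "0 < K" using C \<eta> by (simp add: K_def add_nonneg_pos)
  have KM: "C * norm z \<le> K * \<eta>" using \<eta> by (simp add: K_def field_simps)
  \<comment> \<open>If \<open>K * g n (y i)\<close> exceeded \<open>\<eta>\<close> for all
    \<open>N\<close> vectors, their sum would exceed the bound
    \<open>K * (C * norm z)\<close>.\<close>
  obtain N :: nat where N: "K * (C * norm z) / \<eta> < N" using reals_Archimedean2 by blast
  have "0 \<le> K * (C * norm z) / \<eta>" using K C \<eta> by simp
  then have N0: "0 < N" using N by (cases N) auto
  obtain I where I: "I \<subseteq> S" "finite I" "card I = N" using infinite_arbitrarily_large[OF S(1)] by blast
  obtain y where y: "\<And>i. i \<in> I \<Longrightarrow> 0 \<le> y i" "\<And>i. i \<in> I \<Longrightarrow> g i z \<le> g i (y i) + \<eta>"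
      "(\<Sum>i\<in>I. y i) \<le> z"
    using disjoint_functionals_decomposition[OF I(2) nonneg disj z \<eta>, of "\<lambda>i. i"] by blast
  have y_le: "y i \<le> z" if "i \<in> I" for i
  proof -
    have "y i \<le> (\<Sum>i\<in>I. y i)" using that I(2) y(1) by (intro summand_le_sum) auto
    then show ?thesis using y(3) by (rule order_trans)
  qed
  have gz: "g n z \<le> C * norm z" for n by (rule blinfun_apply_le_norm[OF bound])
  have "\<exists>i\<in>I. K * g n (y i) \<le> \<eta>" for n
  proof (rule ccontr)
    assume "\<not> (\<exists>i\<in>I. K * g n (y i) \<le> \<eta>)"
    then have "\<eta> \<le> K * g n (y i)" if "i \<in> I" for i using that by force
    then have "real N * \<eta> \<le> (\<Sum>i\<in>I. K * g n (y i))"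
      using sum_mono[of I "\<lambda>_. \<eta>" "\<lambda>i. K * g n (y i)"] I(3) by simp
    also have "\<dots> = K * g n (\<Sum>i\<in>I. y i)" by (simp add: blinfun.sum_right sum_distrib_left)
    also have "\<dots> \<le> K * g n z" using K by (intro mult_left_mono blinfun_mono nonneg y(3)) auto
    also have "\<dots> \<le> K * (C * norm z)" using K gz by (intro mult_left_mono) auto
    finally show False using N \<eta> by (simp add: field_simps)
  qed
  then have "\<exists>i\<in>I. infinite {n \<in> S. K * g n (y i) \<le> \<eta>}"
    using pigeonhole_infinite_rel[OF S(1) I(2), of "\<lambda>n i. K * g n (y i) \<le> \<eta>"] by blast
  then obtain i where i: "i \<in> I" "infinite {n \<in> S. K * g n (y i) \<le> \<eta>}" by blast
  define v where "v = pprt (y i - inverse K *\<^sub>R z)"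
  define z' where "z' = pprt (z - K *\<^sub>R y i)"
  have Kz: "0 \<le> inverse K *\<^sub>R z" "0 \<le> K *\<^sub>R y i"
    using K z y(1)[OF i(1)] by (auto intro: scaleR_nonneg_nonneg)
  show ?thesis
  proof (rule that[of v z' i "{n \<in> S. K * g n (y i) \<le> \<eta>}"])
    show "0 \<le> v" "0 \<le> z'" by (auto simp: v_def z'_def)
    show "v \<le> z"
      unfolding v_def using pprt_diff_le[OF y(1)[OF i(1)] Kz(1)] y_le[OF i(1)] by (rule order_trans)
    show "z' \<le> z" unfolding z'_def using z Kz(2) by (rule pprt_diff_le)
    show "inf v z' = 0"
      unfolding v_def z'_def using inf_pprt_diff_scaleR[OF K, of z "y i"] by (subst inf_commute)
    have "g i (inverse K *\<^sub>R z) \<le> \<eta>"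
      using gz[of i] KM K by (simp add: blinfun.scaleR_right field_simps)
    moreover have "g i (y i - inverse K *\<^sub>R z) \<le> g i v"
      unfolding v_def by (intro blinfun_mono nonneg) (simp add: pprt_def)
    moreover have "\<epsilon> < g i z" using i(1) I(1) S(2) by blast
    ultimately show "\<epsilon>' < g i v"
      using y(2)[OF i(1)] unfolding blinfun.diff_right \<eta>_def by argo
    show "\<forall>n\<in>{n \<in> S. K * g n (y i) \<le> \<eta>}. \<epsilon>' < g n z'"
    proof
      fix n assume n: "n \<in> {n \<in> S. K * g n (y i) \<le> \<eta>}"
      have "g n (z - K *\<^sub>R y i) \<le> g n z'"
        unfolding z'_def by (intro blinfun_mono nonneg) (simp add: pprt_def)
      then show "\<epsilon>' < g n z'"
        using n S(2)[of n] \<eta> by (simp add: blinfun.diff_right blinfun.scaleR_right \<eta>_def)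
    qed
  qed (rule i(2))
qed

text \<open>The previous step is iterated inside the remainder that it leaves. The functional large
  at \<open>v n\<close> need not be \<open>g n\<close>, hence the existential over
  \<open>m\<close>.\<close>

lemma disjoint_functionals_imp_disjoint_vectors:
  fixes g :: "nat \<Rightarrow> 'a::banach_lattice \<Rightarrow>\<^sub>L real"
  assumes nonneg: "\<And>n. 0 \<le> g n" and disj: "disjoint_seq g"
    and bound: "\<And>n. norm (g n) \<le> C"
    and a: "0 \<le> a" and "0 < \<delta>" "\<And>n. \<delta> \<le> g n a"
  obtains v where "disjoint_seq v" "\<And>n. 0 \<le> v n" "\<And>n. v n \<le> a" "\<And>n. \<exists>m. \<delta> / 2 < g m (v n)"
proof -
  have inf0: "inf (g m) (g n) = 0" if "m \<noteq> n" for m n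
    using disj nonneg that by (auto simp: disjoint_seq_def abs_of_nonneg)
  \<comment> \<open>Each step must lower the threshold strictly, yet all thresholds have to stay
    above \<open>\<delta> / 2\<close>.\<close>
  define \<epsilon> where "\<epsilon> k = \<delta> / 2 + \<delta> / 4 * (1 / 2) ^ k" for k :: nat
  have \<epsilon>: "\<delta> / 2 < \<epsilon> k" "\<epsilon> (Suc k) < \<epsilon> k" for k
    using \<open>0 < \<delta>\<close> by (auto simp: \<epsilon>_def)
  \<comment> \<open>A state holds the vector \<open>v\<close> split off last, the remainder
    \<open>z\<close> disjoint from it, and infinitely many indices whose functionals are still large
    at \<open>z\<close>. \<open>Q\<close> keeps the next vector and remainder below
    \<open>z\<close>, so later vectors are disjoint from \<open>v\<close>.\<close>
  define P where "P k s \<longleftrightarrow> (case s of (v, z, S) \<Rightarrow> 0 \<le> v \<and> v \<le> a \<and> 0 \<le> z \<and> z \<le> a \<and> inf v z = 0 \<and>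
    (\<exists>m. \<delta> / 2 < g m v) \<and> infinite S \<and> (\<forall>n\<in>S. \<epsilon> k < g n z))" for k s
  define Q where "Q s t \<longleftrightarrow> fst t \<le> fst (snd s) \<and> fst (snd t) \<le> fst (snd s)"
    for s t :: "'a \<times> 'a \<times> nat set"
  have "\<exists>f. \<forall>k. P k (f k) \<and> Q (f k) (f (Suc k))"
  proof (rule dependent_nat_choice)
    \<comment> \<open>The step needs strict inequalities, while \<open>\<delta> \<le> g n a\<close>
      is not strict; five sixths of \<open>\<delta>\<close> lies strictly between
      \<open>\<epsilon> 0\<close>, which is three quarters of it, and
      \<open>\<delta>\<close>.\<close>
    have gt: "\<delta> / 2 + \<delta> / 3 < g n a" for n using assms(6)[of n] \<open>0 < \<delta>\<close> by simp
    have lt: "\<epsilon> 0 < \<delta> / 2 + \<delta> / 3" using \<open>0 < \<delta>\<close> by (simp add: \<epsilon>_def)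
    obtain n v z' S' where *: "0 \<le> v" "v \<le> a" "0 \<le> z'" "z' \<le> a" "inf v z' = 0"
      "\<epsilon> 0 < g n v" "infinite S'" "\<forall>n\<in>S'. \<epsilon> 0 < g n z'"
      by (rule disjoint_functionals_step[OF nonneg inf0 bound a infinite_UNIV_nat gt lt])
    have "\<exists>m. \<delta> / 2 < g m v" using less_trans[OF \<epsilon>(1) *(6)] by blast
    with * show "\<exists>s. P 0 s" unfolding P_def by (intro exI[of _ "(v, z', S')"]) simp
  next
    fix s k assume "P k s"
    then obtain v z S where s: "s = (v, z, S)" and z: "0 \<le> z" "z \<le> a" "infinite S"
      "\<And>n. n \<in> S \<Longrightarrow> \<epsilon> k < g n z"
      by (cases s) (auto simp: P_def)
    obtain n v' z' S' where *: "0 \<le> v'" "v' \<le> z" "0 \<le> z'" "z' \<le> z" "inf v' z' = 0"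
      "\<epsilon> (Suc k) < g n v'" "infinite S'" "\<forall>n\<in>S'. \<epsilon> (Suc k) < g n z'"
      by (rule disjoint_functionals_step[OF nonneg inf0 bound z(1,3,4) \<epsilon>(2)])
    have "\<exists>m. \<delta> / 2 < g m v'" using less_trans[OF \<epsilon>(1) *(6)] by blast
    moreover have "v' \<le> a" "z' \<le> a" using *(2,4) z(2) by (auto intro: order_trans)
    ultimately show "\<exists>t. P (Suc k) t \<and> Q s t"
      using * unfolding P_def Q_def s by (intro exI[of _ "(v', z', S')"]) simp
  qed
  then obtain f where f: "\<And>k. P k (f k)" "\<And>k. Q (f k) (f (Suc k))" by blast
  define v z where "v k = fst (f k)" and "z k = fst (snd (f k))" for k
  have v: "0 \<le> v k" "v k \<le> a" "inf (v k) (z k) = 0" "\<exists>m. \<delta> / 2 < g m (v k)" for k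
    using f(1)[of k] by (auto simp: P_def v_def z_def split: prod.splits)
  have step: "v (Suc k) \<le> z k" "z (Suc k) \<le> z k" for k
    using f(2)[of k] by (auto simp: Q_def v_def z_def)
  have "disjoint_seq v"
  proof (rule disjoint_seqI)
    fix m n :: nat assume "m < n"
    then obtain k where n: "n = Suc k" "m \<le> k" by (cases n) auto
    have "v n \<le> z k" using step(1)[of k] n by simp
    also have "z k \<le> z m" using lift_Suc_antimono_le[of z, OF step(2) n(2)] .
    finally show "inf (v m) (v n) = 0" using v(1)[of m] v(1)[of n] inf_eq_0_mono[OF v(3)[of m]] by blast
  qed (rule v(1))
  then show ?thesis using v by (intro that[of v]) auto
qed

section \<open>Null sequences\<close>

lemma pprt_add_le:
  fixes x y :: "'a::banach_lattice"
  shows "pprt (x + y) \<le> pprt x + pprt y"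
proof -
  have "x + y \<le> pprt x + pprt y" by (intro add_mono) (simp_all add: pprt_def)
  then show ?thesis unfolding pprt_def[of "x + y"] by (intro le_supI) auto
qed

text \<open>The majorant is the norm of the positive part. It vanishes on negative vectors, which
  makes the functional positive.\<close>

lemma norming_functional:
  fixes a :: "'a::banach_lattice"
  assumes "0 \<le> a"
  obtains f :: "'a \<Rightarrow>\<^sub>L real" where "0 \<le> f" "norm f \<le> 1" "f a = norm a"
proof -
  have "sublinear (\<lambda>x :: 'a. norm (pprt x))"
  proof (rule sublinearI)
    fix x y :: 'a
    have "norm (pprt (x + y)) \<le> norm (pprt x + pprt y)"
      using pprt_add_le[of x y] by (intro norm_mono_abs) (simp add: abs_of_nonneg)
    also have "\<dots> \<le> norm (pprt x) + norm (pprt y)" by (rule norm_triangle_ineq)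
    finally show "norm (pprt (x + y)) \<le> norm (pprt x) + norm (pprt y)" .
  qed (simp add: scaleR_pprt[symmetric])
  moreover have "norm (pprt x) \<le> 1 * norm x" for x :: 'a by (simp add: norm_pprt_le)
  ultimately obtain f :: "'a \<Rightarrow>\<^sub>L real" where f: "\<And>x. f x \<le> norm (pprt x)" "f a = norm (pprt a)"
    by (rule Hahn_Banach_sublinear[where a = a]) blast
  show ?thesis
  proof (rule that[of f])
    show "0 \<le> f"
      unfolding less_eq_blinfun_def
    proof (intro allI impI)
      fix x :: 'a assume "0 \<le> x"
      then show "blinfun_apply 0 x \<le> f x" using f(1)[of "- x"] by (simp add: blinfun.minus_right)
    qed
    show "norm f \<le> 1"
    proof (rule norm_blinfun_bound)
      fix x
      have "f x \<le> norm x" "f (- x) \<le> norm x"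
        using f(1)[of x] f(1)[of "- x"] norm_pprt_le[of x] norm_pprt_le[of "- x"] by auto
      then show "norm (f x) \<le> 1 * norm x" by (simp add: blinfun.minus_right)
    qed simp
    show "f a = norm a" using f(2) assms by simp
  qed
qed

text \<open>The majorant is \<open>g \<bar>x\<bar>\<close>, which on the positive cone bounds both
  \<open>h\<close> and \<open>- h\<close> by \<open>g\<close>. The lemma turns largeness at
  \<open>\<bar>a\<bar>\<close> into largeness at \<open>a\<close> while preserving
  disjointness.\<close>

lemma functional_attaining_abs:
  fixes g :: "'a::banach_lattice \<Rightarrow>\<^sub>L real"
  assumes "0 \<le> g"
  obtains h :: "'a \<Rightarrow>\<^sub>L real" where "\<bar>h\<bar> \<le> g" "h a = g \<bar>a\<bar>"
proof -
  have "sublinear (\<lambda>x. g \<bar>x\<bar>)"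
  proof (rule sublinearI)
    fix x y :: 'a
    show "g \<bar>x + y\<bar> \<le> g \<bar>x\<bar> + g \<bar>y\<bar>"
      using blinfun_mono[OF assms abs_triangle_ineq[of x y]] by (simp add: blinfun.add_right)
  qed (simp add: abs_scaleR_nonneg blinfun.scaleR_right)
  moreover have "g \<bar>x\<bar> \<le> norm g * norm x" for x
    using blinfun_norm_interval[of "\<bar>x\<bar>" x g] by simp
  ultimately obtain h :: "'a \<Rightarrow>\<^sub>L real" where h: "\<And>x. h x \<le> g \<bar>x\<bar>" "h a = g \<bar>a\<bar>"
    by (rule Hahn_Banach_sublinear[where a = a]) blast
  have "\<bar>h\<bar> \<le> g"
  proof (rule abs_leI)
    show "h \<le> g" "- h \<le> g"
      unfolding less_eq_blinfun_def blinfun.minus_left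
      using h(1) h(1)[of "- _"] by (auto simp: blinfun.minus_right abs_of_nonneg) (metis abs_of_nonneg)+
  qed
  then show ?thesis using h(2) by (rule that)
qed

text \<open>The witness is the band restriction \<open>y \<mapsto> sup\<^sub>k f (y \<sqinter> k v)\<close>, obtained as a functional that is
  dominated by this sublinear map and agrees with it at \<open>v\<close>.\<close>

lemma restrict_functional:
  fixes f :: "'a::banach_lattice \<Rightarrow>\<^sub>L real"
  assumes f: "0 \<le> f" and v: "0 \<le> v"
  obtains g :: "'a \<Rightarrow>\<^sub>L real" where "0 \<le> g" "g \<le> f" "g v = f v"
    "\<And>y. 0 \<le> y \<Longrightarrow> inf y v = 0 \<Longrightarrow> g y = 0"
    "\<And>y \<eta>. 0 \<le> y \<Longrightarrow> 0 < \<eta> \<Longrightarrow> \<exists>k::nat. g (y - inf y (real k *\<^sub>R v)) \<le> \<eta>"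
proof -
  define p where "p y = (SUP k::nat. f (inf (pprt y) (real k *\<^sub>R v)))" for y
  have kv: "0 \<le> real k *\<^sub>R v" for k using v by (simp add: scaleR_nonneg_nonneg)
  have f_le: "f (inf (pprt y) (real k *\<^sub>R v)) \<le> f (pprt y)" for y k
    by (intro blinfun_mono f) simp
  have p_ge: "f (inf (pprt y) (real k *\<^sub>R v)) \<le> p y" for y k
    unfolding p_def using f_le by (intro cSUP_upper) (auto intro!: bdd_aboveI2)
  have p_le: "p y \<le> c" if "\<And>k::nat. f (inf (pprt y) (real k *\<^sub>R v)) \<le> c" for y c
    unfolding p_def using that by (intro cSUP_least) auto
  have p_le_f: "p y \<le> f (pprt y)" for y by (rule p_le) (rule f_le)
  have "sublinear p"
  proof (rule sublinearI)
    fix x y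
    show "p (x + y) \<le> p x + p y"
    proof (rule p_le)
      fix k :: nat
      have "inf (pprt (x + y)) (real k *\<^sub>R v) \<le> inf (pprt x + pprt y) (real k *\<^sub>R v)"
        by (intro inf_mono pprt_add_le order_refl)
      also have "\<dots> \<le> inf (pprt x) (real k *\<^sub>R v) + inf (pprt y) (real k *\<^sub>R v)"
        using kv by (intro inf_add_le) auto
      finally have "f (inf (pprt (x + y)) (real k *\<^sub>R v)) \<le>
          f (inf (pprt x) (real k *\<^sub>R v)) + f (inf (pprt y) (real k *\<^sub>R v))"
        using blinfun_mono[OF f] by (simp add: blinfun.add_right[symmetric])
      then show "f (inf (pprt (x + y)) (real k *\<^sub>R v)) \<le> p x + p y"
        using p_ge[of x k] p_ge[of y k] by linarith
    qed
  next
    fix t :: real and x assume t: "0 < t"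
    show "p (t *\<^sub>R x) \<le> t * p x"
    proof (rule p_le)
      fix k :: nat
      \<comment> \<open>\<open>j\<close> is chosen with \<open>k \<le> t * j\<close>, so that the
        factor \<open>t\<close> can be pulled out of the truncation.\<close>
      obtain j :: nat where j: "real k / t < j" using reals_Archimedean2 by blast
      then have "real k *\<^sub>R v \<le> (t * real j) *\<^sub>R v"
        using t v by (intro scaleR_right_mono) (auto simp: field_simps)
      then have "inf (pprt (t *\<^sub>R x)) (real k *\<^sub>R v) \<le> inf (t *\<^sub>R pprt x) (t *\<^sub>R (real j *\<^sub>R v))"
        using t by (intro inf_mono) (simp_all add: scaleR_pprt)
      also have "\<dots> = t *\<^sub>R inf (pprt x) (real j *\<^sub>R v)" using t by (simp only: scaleR_inf)
      finally have "f (inf (pprt (t *\<^sub>R x)) (real k *\<^sub>R v)) \<le> t * f (inf (pprt x) (real j *\<^sub>R v))"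
        using blinfun_mono[OF f] by (metis blinfun.scaleR_right real_scaleR_def)
      also have "\<dots> \<le> t * p x" using t p_ge by (intro mult_left_mono) auto
      finally show "f (inf (pprt (t *\<^sub>R x)) (real k *\<^sub>R v)) \<le> t * p x" .
    qed
  qed
  moreover have "p x \<le> norm f * norm x" for x
  proof -
    have "f (pprt x) \<le> norm f * norm (pprt x)" by (rule blinfun_apply_le_norm) simp
    also have "\<dots> \<le> norm f * norm x" by (intro mult_left_mono norm_pprt_le) simp
    finally show ?thesis using p_le_f[of x] by linarith
  qed
  ultimately obtain g :: "'a \<Rightarrow>\<^sub>L real" where g: "\<And>x. g x \<le> p x" "g v = p v"
    by (rule Hahn_Banach_sublinear[where a = v]) blast
  have g0: "0 \<le> g"
    unfolding less_eq_blinfun_def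
  proof (intro allI impI)
    fix x :: 'a assume "0 \<le> x"
    then have "p (- x) \<le> 0" using p_le_f[of "- x"] by simp
    then show "blinfun_apply 0 x \<le> g x" using g(1)[of "- x"] by (simp add: blinfun.minus_right)
  qed
  show ?thesis
  proof (rule that[of g])
    show "0 \<le> g" by (rule g0)
    show "g \<le> f"
      unfolding less_eq_blinfun_def
    proof (intro allI impI)
      fix x :: 'a assume "0 \<le> x"
      then show "g x \<le> f x" using g(1)[of x] p_le_f[of x] by simp
    qed
    show "g v = f v" using g(2) p_le_f[of v] p_ge[of v 1] v by simp
  next
    fix y assume y: "0 \<le> y" "inf y v = 0"
    have "inf y (real k *\<^sub>R v) = 0" for k
    proof (cases "k = 0")
      case False
      then show ?thesis using y v by (intro inf_scaleR_eq_0) auto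
    qed (use y in \<open>simp add: inf_absorb2\<close>)
    then have "p y \<le> 0" using y by (intro p_le) simp
    then show "g y = 0" using g(1)[of y] blinfun_nonneg[OF g0 y(1)] by simp
  next
    fix y :: 'a and \<eta> :: real assume y: "0 \<le> y" "0 < \<eta>"
    have "\<exists>k::nat. p y - \<eta> < f (inf (pprt y) (real k *\<^sub>R v))"
    proof (rule ccontr)
      assume "\<not> ?thesis"
      then have "p y \<le> p y - \<eta>" by (intro p_le) (simp add: not_less)
      then show False using y(2) by simp
    qed
    then obtain k :: nat where k: "p y - \<eta> < f (inf y (real k *\<^sub>R v))" using y(1) by auto
    \<comment> \<open>\<open>f a\<close> is within \<open>\<eta>\<close> of the supremum
      \<open>p y\<close>. A truncation of \<open>y - a\<close> at \<open>j\<close> times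
      \<open>v\<close>, added to \<open>a\<close>, stays below the truncation of \<open>y\<close> at
      \<open>j + k\<close> times \<open>v\<close>; hence \<open>f\<close> is at most
      \<open>\<eta>\<close> on it.\<close>
    define a where "a = inf y (real k *\<^sub>R v)"
    have "p (y - a) \<le> \<eta>"
    proof (rule p_le)
      fix j :: nat
      have pos: "0 \<le> y - a" by (simp add: a_def del: diff_inf_eq_sup)
      have "inf (y - a) (real j *\<^sub>R v) + a = inf y (real j *\<^sub>R v + a)"
        by (simp only: add_inf_distrib_right diff_add_cancel)
      also have "\<dots> \<le> inf y (real (j + k) *\<^sub>R v)"
      proof (rule inf_mono[OF order_refl])
        have "a \<le> real k *\<^sub>R v" by (simp add: a_def)
        then show "real j *\<^sub>R v + a \<le> real (j + k) *\<^sub>R v" by (simp add: scaleR_add_left)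
      qed
      finally have "f (inf (y - a) (real j *\<^sub>R v)) + f a \<le> f (inf y (real (j + k) *\<^sub>R v))"
        using blinfun_mono[OF f] by (simp only: blinfun.add_right[symmetric])
      also have "\<dots> \<le> p y" using p_ge[of y "j + k"] y(1) by simp
      finally show "f (inf (pprt (y - a)) (real j *\<^sub>R v)) \<le> \<eta>"
        using k pos by (simp add: a_def[symmetric])
    qed
    then have "g (y - a) \<le> \<eta>" using g(1)[of "y - a"] by linarith
    then show "\<exists>k::nat. g (y - inf y (real k *\<^sub>R v)) \<le> \<eta>" unfolding a_def by blast
  qed
qed

text \<open>Up to a small error \<open>g m\<close> sees only the truncation of \<open>x\<close> at a
  multiple of \<open>v m\<close>. That truncation is disjoint from \<open>v n\<close>, so
  \<open>g n\<close> vanishes on it, and the Riesz-Kantorovich criterion applies to this splitting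
  of \<open>x\<close>.\<close>

lemma disjoint_restrictions:
  fixes f :: "nat \<Rightarrow> 'a::banach_lattice \<Rightarrow>\<^sub>L real"
  assumes f: "\<And>n. 0 \<le> f n" and v: "\<And>n. 0 \<le> v n" "disjoint_seq v"
  obtains g where "disjoint_seq g" "\<And>n. 0 \<le> g n" "\<And>n. g n \<le> f n" "\<And>n. g n (v n) = f n (v n)"
proof -
  have "\<exists>g. 0 \<le> g \<and> g \<le> f n \<and> g (v n) = f n (v n) \<and>
      (\<forall>y. 0 \<le> y \<longrightarrow> inf y (v n) = 0 \<longrightarrow> g y = 0) \<and>
      (\<forall>y \<eta>. 0 \<le> y \<longrightarrow> 0 < \<eta> \<longrightarrow> (\<exists>k::nat. g (y - inf y (real k *\<^sub>R v n)) \<le> \<eta>))" for n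
    by (rule restrict_functional[OF f[of n] v(1)[of n]]) blast
  then obtain g where g: "\<And>n. 0 \<le> g n" "\<And>n. g n \<le> f n" "\<And>n. g n (v n) = f n (v n)"
    "\<And>n y. 0 \<le> y \<Longrightarrow> inf y (v n) = 0 \<Longrightarrow> g n y = 0"
    "\<And>n y \<eta>. 0 \<le> y \<Longrightarrow> 0 < \<eta> \<Longrightarrow> \<exists>k::nat. g n (y - inf y (real k *\<^sub>R v n)) \<le> \<eta>"
    by metis
  have "disjoint_seq g"
  proof (rule disjoint_seqI[OF g(1)])
    fix m n :: nat assume "m < n"
    then have mn: "inf (v m) (v n) = 0"
      using v unfolding disjoint_seq_def by (metis abs_of_nonneg less_irrefl)
    show "inf (g m) (g n) = 0"
    proof (rule inf_blinfun_eq_0I[OF g(1) g(1)])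
      fix x :: 'a and \<eta> :: real assume x: "0 \<le> x" "0 < \<eta>"
      obtain k :: nat where k: "g m (x - inf x (real k *\<^sub>R v m)) \<le> \<eta>" using g(5)[OF x] by blast
      define y where "y = inf x (real k *\<^sub>R v m)"
      have y: "0 \<le> y" "y \<le> x" "y \<le> real k *\<^sub>R v m"
        using x v by (auto simp: y_def intro: scaleR_nonneg_nonneg)
      have "inf (real k *\<^sub>R v m) (v n) = 0"
      proof (cases "k = 0")
        case False
        then have "inf (v n) (real k *\<^sub>R v m) = 0"
          using mn v by (intro inf_scaleR_eq_0) (auto simp: inf_commute)
        then show ?thesis by (subst inf_commute)
      qed (use v in \<open>simp add: inf_absorb1\<close>)
      then have "inf y (v n) = 0" using y v(1)[of n] inf_eq_0_mono by blast
      then have "g n y = 0" using g(4) y by blast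
      then show "\<exists>y. 0 \<le> y \<and> y \<le> x \<and> g m (x - y) + g n y \<le> \<eta>"
        using k y unfolding y_def by (intro exI[of _ "inf x (real k *\<^sub>R v m)"]) simp
    qed
  qed
  then show ?thesis using g by (intro that[of g]) auto
qed

section \<open>Disjoint sequences and unbounded weak convergence\<close>

lemma disjoint_seq_mono:
  assumes "disjoint_seq x" "\<And>n. \<bar>y n\<bar> \<le> \<bar>x n\<bar>"
  shows "disjoint_seq y"
  unfolding disjoint_seq_def
proof (intro allI impI)
  fix n m :: nat assume "n \<noteq> m"
  then have "inf \<bar>x n\<bar> \<bar>x m\<bar> = 0" using assms(1) by (simp add: disjoint_seq_def)
  then show "inf \<bar>y n\<bar> \<bar>y m\<bar> = 0" by (rule inf_eq_0_mono) (simp_all add: assms(2))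
qed

text \<open>Finite sums of disjoint positive vectors are suprema.\<close>

lemma disjoint_seq_sum_le:
  fixes w :: "nat \<Rightarrow> 'a::banach_lattice"
  assumes "disjoint_seq w" "\<And>n. 0 \<le> w n" "\<And>n. w n \<le> u"
  shows "(\<Sum>i<n. w i) \<le> u"
proof (induction n)
  case 0
  then show ?case using order_trans[OF assms(2)[of 0] assms(3)[of 0]] by simp
next
  case (Suc n)
  have "inf (\<Sum>i<n. w i) (w n) = 0"
    using assms(1,2) unfolding disjoint_seq_def
    by (intro inf_sum_eq_0) (auto simp: abs_of_nonneg)
  then have "(\<Sum>i<Suc n. w i) = sup (\<Sum>i<n. w i) (w n)" by (simp add: sup_eq_add_if_disjoint)
  then show ?case using Suc assms(3) by simp
qed

lemma disjoint_seq_inf: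
  fixes x :: "nat \<Rightarrow> 'a::banach_lattice"
  assumes "disjoint_seq x" "0 \<le> u"
  shows "disjoint_seq (\<lambda>n. inf \<bar>x n\<bar> u)"
  by (rule disjoint_seq_mono[OF assms(1)]) (use assms(2) in \<open>simp add: abs_of_nonneg\<close>)

text \<open>The truncations are disjoint and below \<open>u\<close>, so the series of their values
  under \<open>\<bar>\<phi>\<bar>\<close> has partial sums at most
  \<open>\<bar>\<phi>\<bar> u\<close> and its terms tend to zero.\<close>

lemma disjoint_seq_uaw_null:
  fixes x :: "nat \<Rightarrow> 'a::banach_lattice"
  assumes "disjoint_seq x"
  shows "uaw_null x"
  unfolding uaw_tendsto_def weak_tendsto_def
proof (intro allI impI)
  fix u :: 'a and \<phi> :: "'a \<Rightarrow>\<^sub>L real" assume u: "0 \<le> u"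
  define w where "w = (\<lambda>n. inf \<bar>x n\<bar> u)"
  have w: "disjoint_seq w" "\<And>n. 0 \<le> w n" "\<And>n. w n \<le> u"
    using disjoint_seq_inf[OF assms u] u by (auto simp: w_def)
  have "summable (\<lambda>n. \<bar>\<phi>\<bar> (w n))"
  proof (rule summableI_nonneg_bounded)
    show "0 \<le> \<bar>\<phi>\<bar> (w n)" for n using w(2) by (intro blinfun_nonneg) auto
    show "(\<Sum>i<n. \<bar>\<phi>\<bar> (w i)) \<le> \<bar>\<phi>\<bar> u" for n
      using blinfun_mono[OF _ disjoint_seq_sum_le[OF w, of n], of "\<bar>\<phi>\<bar>"]
      by (simp add: blinfun.sum_right)
  qed
  then have "(\<lambda>n. \<bar>\<phi>\<bar> (w n)) \<longlonglongrightarrow> 0" by (rule summable_LIMSEQ_zero)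
  then have "(\<lambda>n. \<phi> (w n)) \<longlonglongrightarrow> 0"
  proof (rule Lim_null_comparison[rotated], intro always_eventually allI)
    fix n show "norm (\<phi> (w n)) \<le> \<bar>\<phi>\<bar> (w n)"
      using abs_blinfun_apply_le[of \<phi> "w n"] w(2)[of n] by (simp add: abs_of_nonneg)
  qed
  then show "(\<lambda>n. \<phi> (inf \<bar>x n - 0\<bar> u)) \<longlonglongrightarrow> \<phi> 0"
    by (simp add: w_def blinfun.zero_right)
qed

section \<open>Order convergence in the dual and passage to unbounded weak-star convergence\<close>

text \<open>Monotone convergence gives the limit on positive vectors, differences give it
  everywhere, and \<open>norm u\<close> bounds it. It later serves as the supremum of the partial
  sums of a disjoint sequence.\<close>

lemma blinfun_incseq_limit:
  fixes F :: "nat \<Rightarrow> 'a::banach_lattice \<Rightarrow>\<^sub>L real"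
  assumes inc: "\<And>n. F n \<le> F (Suc n)" and F: "\<And>n. 0 \<le> F n" "\<And>n. F n \<le> u"
  obtains S where "\<And>x. (\<lambda>n. F n x) \<longlonglongrightarrow> blinfun_apply S x"
proof -
  have conv_pos: "convergent (\<lambda>n. F n x)" if x: "0 \<le> x" for x
  proof (rule Bseq_monoseq_convergent)
    have "incseq (\<lambda>n. F n x)" using blinfun_le_apply[OF inc x] by (rule incseq_SucI)
    then show "monoseq (\<lambda>n. F n x)" by (rule incseq_imp_monoseq)
    have "norm (F n x) \<le> u x" for n
      using blinfun_nonneg[OF F(1)[of n] x] blinfun_le_apply[OF F(2)[of n] x] by simp
    then show "Bseq (\<lambda>n. F n x)" by (rule BseqI')
  qed
  have conv: "convergent (\<lambda>n. F n x)" for x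
  proof -
    have "F n x = F n (pprt x) - F n (pprt (- x))" for n
      by (simp only: blinfun.diff_right[symmetric] prt_diff[of x, symmetric])
    then show ?thesis using convergent_diff[OF conv_pos conv_pos, of "pprt x" "pprt (- x)"] by simp
  qed
  define S where "S x = lim (\<lambda>n. F n x)" for x
  have S: "(\<lambda>n. F n x) \<longlonglongrightarrow> S x" for x
    using conv by (simp add: S_def convergent_LIMSEQ_iff)
  have "bounded_linear S"
  proof (rule bounded_linear_intro)
    show "S (x + y) = S x + S y" for x y
      using S[of "x + y"] tendsto_add[OF S[of x] S[of y]]
      by (simp add: blinfun.add_right LIMSEQ_unique)
    show "S (r *\<^sub>R x) = r *\<^sub>R S x" for r x
      using S[of "r *\<^sub>R x"] tendsto_mult_left[OF S[of x], of r]
      by (simp add: blinfun.scaleR_right LIMSEQ_unique)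
    show "norm (S x) \<le> norm x * norm u" for x
    proof (rule Lim_bounded[OF tendsto_norm[OF S]], intro allI impI)
      fix n
      have "norm (F n) \<le> norm u" using F by (intro norm_mono_abs) (metis abs_of_nonneg order_trans)
      then show "norm (F n x) \<le> norm x * norm u"
        using norm_blinfun[of "F n" x] mult_right_mono[of "norm (F n)" "norm u" "norm x"]
        by (simp add: mult.commute)
    qed
  qed
  then have "blinfun_apply (Blinfun S) = S" by (rule bounded_linear_Blinfun_apply)
  then show ?thesis using S by (intro that[of "Blinfun S"]) simp
qed

text \<open>The partial sums \<open>F n\<close> of the truncations increase to a functional
  \<open>S\<close>. For \<open>m \<le> n\<close> the vector \<open>F m + w n\<close> is below
  \<open>F (Suc n)\<close>, so \<open>w n\<close> is below the tail \<open>S - F m\<close>, and the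
  tails decrease to zero.\<close>

lemma disjoint_seq_uo_null_dual:
  fixes x :: "nat \<Rightarrow> 'a::banach_lattice \<Rightarrow>\<^sub>L real"
  assumes "disjoint_seq x"
  shows "uo_null x"
  unfolding uo_tendsto_def
proof (intro allI impI)
  fix u :: "'a \<Rightarrow>\<^sub>L real" assume u: "0 \<le> u"
  define w where "w = (\<lambda>n. inf \<bar>x n\<bar> u)"
  have w: "disjoint_seq w" "\<And>n. 0 \<le> w n" "\<And>n. w n \<le> u"
    using disjoint_seq_inf[OF assms u] u by (auto simp: w_def)
  define F where "F n = (\<Sum>i<n. w i)" for n
  have F: "F n \<le> F (Suc n)" "0 \<le> F n" "F n \<le> u" for n
    using w(2) disjoint_seq_sum_le[OF w] by (auto simp: F_def intro: sum_nonneg)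
  obtain S where S: "\<And>y. (\<lambda>n. F n y) \<longlonglongrightarrow> blinfun_apply S y"
    using blinfun_incseq_limit[of F u] F by blast
  have F_le_S: "F n \<le> S" for n
    unfolding less_eq_blinfun_def
  proof (intro allI impI)
    fix y :: 'a assume "0 \<le> y"
    then have "incseq (\<lambda>n. F n y)" by (intro incseq_SucI blinfun_le_apply F)
    then show "F n y \<le> S y" using S by (rule incseq_le)
  qed
  have F_mono: "F m \<le> F n" if "m \<le> n" for m n using lift_Suc_mono_le[of F m n] F(1) that by blast
  \<comment> \<open>\<open>order_tendsto\<close> takes its index set inside the space, so the tails
    are indexed by themselves with the reversed order.\<close>
  define Y where "Y = range (\<lambda>n. S - F n)"
  have "net_decreasing_to_0 Y (\<lambda>a b. b \<le> a) (\<lambda>a. a)"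
    unfolding net_decreasing_to_0_def
  proof (intro conjI)
    show "\<forall>i\<in>Y. \<forall>j\<in>Y. \<exists>k\<in>Y. k \<le> i \<and> k \<le> j"
    proof (intro ballI)
      fix i j assume "i \<in> Y" "j \<in> Y"
      then obtain m n where "i = S - F m" "j = S - F n" by (auto simp: Y_def)
      then have "S - F (max m n) \<le> i" "S - F (max m n) \<le> j"
        using F_mono by (auto intro: diff_left_mono)
      then show "\<exists>k\<in>Y. k \<le> i \<and> k \<le> j" unfolding Y_def by blast
    qed
    show "\<forall>i\<in>Y. 0 \<le> i" using F_le_S by (auto simp: Y_def)
    show "\<forall>z. (\<forall>i\<in>Y. z \<le> i) \<longrightarrow> z \<le> 0"
    proof (intro allI impI)
      fix z assume z: "\<forall>i\<in>Y. z \<le> i"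
      show "z \<le> 0"
        unfolding less_eq_blinfun_def
      proof (intro allI impI)
        fix y :: 'a assume y: "0 \<le> y"
        have "z y \<le> S y - F n y" for n
          using z blinfun_le_apply[of z "S - F n" y] y by (auto simp: Y_def blinfun.diff_left)
        moreover have "(\<lambda>n. S y - F n y) \<longlonglongrightarrow> S y - S y" by (intro tendsto_intros S)
        ultimately have "z y \<le> S y - S y" by (intro LIMSEQ_le_const) auto
        then show "z y \<le> blinfun_apply 0 y" by simp
      qed
    qed
  qed (auto simp: Y_def intro: reflp_onI transp_onI)
  moreover have "\<forall>\<beta>\<in>Y. \<forall>\<^sub>F n in sequentially. \<bar>inf \<bar>x n - 0\<bar> u - 0\<bar> \<le> \<beta>"
  proof
    fix \<beta> assume "\<beta> \<in> Y"
    then obtain m where \<beta>: "\<beta> = S - F m" by (auto simp: Y_def)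
    show "\<forall>\<^sub>F n in sequentially. \<bar>inf \<bar>x n - 0\<bar> u - 0\<bar> \<le> \<beta>"
    proof (rule eventually_sequentiallyI)
      fix n assume "m \<le> n"
      then have "F m + w n \<le> F n + w n" using F_mono by (intro add_right_mono) auto
      also have "\<dots> = F (Suc n)" by (simp add: F_def)
      also have "\<dots> \<le> S" by (rule F_le_S)
      finally have "w n \<le> S - F m" by (simp add: algebra_simps)
      then show "\<bar>inf \<bar>x n - 0\<bar> u - 0\<bar> \<le> \<beta>" using w(2)[of n] \<beta> by (simp add: w_def abs_of_nonneg)
    qed
  qed
  ultimately show "order_tendsto (\<lambda>n. inf \<bar>x n - 0\<bar> u) 0 sequentially"
    unfolding order_tendsto_def by blast
qed

text \<open>A functional below all members of the net is found under the sublinear map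
  \<open>x \<mapsto> inf\<^sub>\<beta> y\<^sub>\<beta> (x\<^sup>+)\<close>, which is subadditive because the net is directed.\<close>

lemma net_decreasing_to_0_dual_apply:
  fixes y :: "'i \<Rightarrow> 'a::banach_lattice \<Rightarrow>\<^sub>L real"
  assumes net: "net_decreasing_to_0 B r y" and e: "0 \<le> e" and "0 < \<eta>"
  obtains \<beta> where "\<beta> \<in> B" "y \<beta> e < \<eta>"
proof -
  have B: "B \<noteq> {}" "\<And>i. i \<in> B \<Longrightarrow> 0 \<le> y i"
      "\<And>z. (\<And>i. i \<in> B \<Longrightarrow> z \<le> y i) \<Longrightarrow> z \<le> 0"
    using net unfolding net_decreasing_to_0_def by auto
  have dir: "\<exists>k\<in>B. y k \<le> y i \<and> y k \<le> y j" if "i \<in> B" "j \<in> B" for i j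
    using net that unfolding net_decreasing_to_0_def by meson
  define p where "p x = (INF \<beta>\<in>B. y \<beta> (pprt x))" for x
  have p_le: "p x \<le> y \<beta> (pprt x)" if "\<beta> \<in> B" for \<beta> x
    unfolding p_def using that B(2)
    by (intro cINF_lower) (auto intro!: bdd_belowI2[where m = 0] blinfun_nonneg)
  have p_ge: "c \<le> p x" if "\<And>\<beta>. \<beta> \<in> B \<Longrightarrow> c \<le> y \<beta> (pprt x)" for c x
    unfolding p_def using that B(1) by (intro cINF_greatest) auto
  have "sublinear p"
  proof (rule sublinearI)
    fix x x'
    have add: "p (x + x') \<le> y i (pprt x) + y j (pprt x')" if ij: "i \<in> B" "j \<in> B" for i j
    proof -
      obtain k where k: "k \<in> B" "y k \<le> y i" "y k \<le> y j" using dir[OF ij] by blast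
      have "p (x + x') \<le> y k (pprt (x + x'))" by (rule p_le[OF k(1)])
      also have "\<dots> \<le> y k (pprt x + pprt x')" by (intro blinfun_mono B k pprt_add_le)
      also have "\<dots> = y k (pprt x) + y k (pprt x')" by (rule blinfun.add_right)
      also have "\<dots> \<le> y i (pprt x) + y j (pprt x')"
        by (intro add_mono blinfun_le_apply k zero_le_pprt)
      finally show ?thesis .
    qed
    have "p (x + x') - p x \<le> p x'"
    proof (rule p_ge)
      fix j assume j: "j \<in> B"
      have "p (x + x') - y j (pprt x') \<le> p x"
        by (rule p_ge) (use add j in \<open>simp add: algebra_simps\<close>)
      then show "p (x + x') - p x \<le> y j (pprt x')" by simp
    qed
    then show "p (x + x') \<le> p x + p x'" by simp
  next
    fix t :: real and x assume t: "0 < t"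
    have "p (t *\<^sub>R x) / t \<le> p x"
    proof (rule p_ge)
      fix \<beta> assume "\<beta> \<in> B"
      then have "p (t *\<^sub>R x) \<le> t * y \<beta> (pprt x)"
        using p_le[of \<beta> "t *\<^sub>R x"] t by (simp add: scaleR_pprt[symmetric] blinfun.scaleR_right)
      then show "p (t *\<^sub>R x) / t \<le> y \<beta> (pprt x)" using t by (simp add: field_simps)
    qed
    then show "p (t *\<^sub>R x) \<le> t * p x" using t by (simp add: field_simps)
  qed
  moreover obtain i where i: "i \<in> B" using B(1) by blast
  have "p x \<le> norm (y i) * norm x" for x
  proof -
    have "y i (pprt x) \<le> norm (y i) * norm (pprt x)" by (rule blinfun_apply_le_norm) simp
    also have "\<dots> \<le> norm (y i) * norm x" by (intro mult_left_mono norm_pprt_le) simp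
    finally show ?thesis using p_le[OF i, of x] by linarith
  qed
  ultimately obtain f :: "'a \<Rightarrow>\<^sub>L real" where f: "\<And>x. f x \<le> p x" "f e = p e"
    by (rule Hahn_Banach_sublinear[where a = e]) blast
  have "f \<le> y j" if "j \<in> B" for j
    unfolding less_eq_blinfun_def
  proof (intro allI impI)
    fix x :: 'a assume "0 \<le> x"
    then show "f x \<le> y j x" using f(1)[of x] p_le[OF that, of x] by simp
  qed
  \<comment> \<open>A lower bound of the net is at most 0; as \<open>f e = p e\<close>, the infimum
    of the values at \<open>e\<close> cannot be positive.\<close>
  then have "f \<le> 0" by (rule B(3))
  then have "p e \<le> 0" using blinfun_le_apply[of f 0 e] e f(2) by simp
  show ?thesis
  proof (rule ccontr)
    assume "\<not> thesis"
    then have "\<eta> \<le> y \<beta> (pprt e)" if "\<beta> \<in> B" for \<beta> using that e \<open>\<And>\<beta>. \<beta> \<in> B \<Longrightarrow> y \<beta> e < \<eta> \<Longrightarrow> thesis\<close> by fastforce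
    then have "\<eta> \<le> p e" by (rule p_ge)
    then show False using \<open>p e \<le> 0\<close> \<open>0 < \<eta>\<close> by simp
  qed
qed

lemma uo_null_imp_uaw_star_null:
  fixes x :: "nat \<Rightarrow> 'a::banach_lattice \<Rightarrow>\<^sub>L real"
  assumes "uo_null x"
  shows "uaw_star_null x"
  unfolding uaw_star_tendsto_def weak_star_tendsto_def
proof (intro allI impI)
  fix u :: "'a \<Rightarrow>\<^sub>L real" and e assume u: "0 \<le> u"
  define w where "w n = inf \<bar>x n - 0\<bar> u" for n
  have w0: "0 \<le> w n" for n using u by (simp add: w_def)
  obtain B r and y :: "('a \<Rightarrow>\<^sub>L real) \<Rightarrow> 'a \<Rightarrow>\<^sub>L real" where y: "net_decreasing_to_0 B r y"
      "\<And>\<beta>. \<beta> \<in> B \<Longrightarrow> \<forall>\<^sub>F n in sequentially. \<bar>w n - 0\<bar> \<le> y \<beta>"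
    using assms u unfolding uo_tendsto_def order_tendsto_def w_def by blast
  have "(\<lambda>n. w n e) \<longlonglongrightarrow> 0"
  proof (rule tendstoI)
    fix \<eta> :: real assume "0 < \<eta>"
    then obtain \<beta> where \<beta>: "\<beta> \<in> B" "y \<beta> \<bar>e\<bar> < \<eta>"
      using net_decreasing_to_0_dual_apply[OF y(1), of "\<bar>e\<bar>" \<eta>] by auto
    show "\<forall>\<^sub>F n in sequentially. dist (w n e) 0 < \<eta>"
      using y(2)[OF \<beta>(1)]
    proof eventually_elim
      case (elim n)
      then have "w n \<bar>e\<bar> \<le> y \<beta> \<bar>e\<bar>" using w0[of n] by (intro blinfun_le_apply) (simp_all add: abs_of_nonneg)
      then show ?case using \<beta>(2) abs_blinfun_apply_le[of "w n" e] w0[of n] by (simp add: abs_of_nonneg)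
    qed
  qed
  then show "(\<lambda>n. blinfun_apply (inf \<bar>x n - 0\<bar> u) e) \<longlonglongrightarrow> blinfun_apply 0 e" by (simp add: w_def)
qed

text \<open>Evaluation at a vector is a bounded functional on the dual, so weak convergence there
  contains weak-star convergence.\<close>

lemma uaw_null_imp_uaw_star_null:
  fixes x :: "nat \<Rightarrow> 'a::banach_lattice \<Rightarrow>\<^sub>L real"
  assumes "uaw_null x"
  shows "uaw_star_null x"
  unfolding uaw_star_tendsto_def weak_star_tendsto_def
proof (intro allI impI)
  fix u :: "'a \<Rightarrow>\<^sub>L real" and e assume u: "0 \<le> u"
  define ev where "ev = Blinfun (\<lambda>f :: 'a \<Rightarrow>\<^sub>L real. f e)"
  have ev: "blinfun_apply ev f = f e" for f
    unfolding ev_def by (simp add: bounded_linear_Blinfun_apply blinfun.bounded_linear_left)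
  have "(\<lambda>n. blinfun_apply ev (inf \<bar>x n - 0\<bar> u)) \<longlonglongrightarrow> blinfun_apply ev 0"
    using assms u unfolding uaw_tendsto_def weak_tendsto_def by blast
  then show "(\<lambda>n. blinfun_apply (inf \<bar>x n - 0\<bar> u) e) \<longlonglongrightarrow> blinfun_apply 0 e"
    by (simp only: ev)
qed

section \<open>L-weakly compact sets and null sequences\<close>

lemma L_weakly_compactD:
  assumes "L_weakly_compact A" "disjoint_seq v" "\<And>n. 0 \<le> v n" "\<And>n. \<exists>a\<in>A. v n \<le> \<bar>a\<bar>"
  shows "v \<longlonglongrightarrow> 0"
proof -
  have "range v \<subseteq> solid hull A"
    using assms(3,4) by (auto simp: solid_hull_eq abs_of_nonneg)
  then show ?thesis using assms(1,2) by (simp add: L_weakly_compact_def)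
qed

lemma norm_abs: "norm \<bar>x\<bar> = norm x" for x :: "'a::banach_lattice"
  by (intro antisym norm_mono_abs) simp_all

text \<open>A subsequence keeps the norms away from zero, and absolute values keep the sequence
  disjoint and in the solid hull.\<close>

lemma not_L_weakly_compactD:
  fixes A :: "'a::banach_lattice set"
  assumes "bounded A" "\<not> L_weakly_compact A"
  obtains x \<epsilon> where "0 < \<epsilon>" "disjoint_seq x" "\<And>n. 0 \<le> x n" "\<And>n. \<epsilon> \<le> norm (x n)"
    "\<And>n. \<exists>a\<in>A. x n \<le> \<bar>a\<bar>"
proof -
  obtain x where x: "disjoint_seq x" "range x \<subseteq> solid hull A" "\<not> x \<longlonglongrightarrow> 0"
    using assms by (auto simp: L_weakly_compact_def)
  obtain \<epsilon> where \<epsilon>: "0 < \<epsilon>" "\<And>N. \<exists>n\<ge>N. \<epsilon> \<le> norm (x n)"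
    using x(3) by (auto simp: LIMSEQ_iff not_less)
  then have "infinite {n. \<epsilon> \<le> norm (x n)}" by (auto simp: infinite_nat_iff_unbounded_le)
  then obtain r :: "nat \<Rightarrow> nat" where r: "strict_mono r" "\<And>n. \<epsilon> \<le> norm (x (r n))"
    using infinite_enumerate by blast
  show ?thesis
  proof (rule that[of \<epsilon> "\<lambda>n. \<bar>x (r n)\<bar>"])
    show "disjoint_seq (\<lambda>n. \<bar>x (r n)\<bar>)"
      using x(1) strict_mono_eq[OF r(1)] by (simp add: disjoint_seq_def)
    show "\<exists>a\<in>A. \<bar>x (r n)\<bar> \<le> \<bar>a\<bar>" for n using x(2) by (auto simp: solid_hull_eq)
  qed (use \<epsilon>(1) r(2) in \<open>simp_all add: norm_abs\<close>)
qed

lemma bounded_range_norm: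
  assumes "bounded (range x)"
  obtains M where "0 < M" "\<And>n. norm (x n) \<le> M"
  using assms by (auto simp: bounded_pos)

text \<open>Replaces suprema by the uniform bounds used in all estimates. Nonemptiness and
  boundedness above make \<open>SUP\<close> a genuine supremum on the reals.\<close>

lemma SUP_tendsto_0_iff:
  fixes \<phi> :: "nat \<Rightarrow> 'i \<Rightarrow> real"
  assumes "A \<noteq> {}" and nonneg: "\<And>n x. 0 \<le> \<phi> n x" and bdd: "\<And>n. bdd_above (\<phi> n ` A)"
  shows "(\<lambda>n. SUP x\<in>A. \<phi> n x) \<longlonglongrightarrow> 0 \<longleftrightarrow>
    (\<forall>\<delta>>0. \<forall>\<^sub>F n in sequentially. \<forall>x\<in>A. \<phi> n x \<le> \<delta>)" (is "?l \<longleftrightarrow> ?r")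
proof
  assume l: ?l
  show ?r
  proof (intro allI impI)
    fix \<delta> :: real assume "0 < \<delta>"
    from order_tendstoD(2)[OF l this]
    show "\<forall>\<^sub>F n in sequentially. \<forall>x\<in>A. \<phi> n x \<le> \<delta>"
    proof eventually_elim
      case (elim n)
      show ?case
      proof
        fix x assume "x \<in> A"
        then have "\<phi> n x \<le> (SUP x\<in>A. \<phi> n x)" using bdd by (intro cSUP_upper)
        then show "\<phi> n x \<le> \<delta>" using elim by simp
      qed
    qed
  qed
next
  assume r: ?r
  show ?l
  proof (rule tendstoI)
    fix \<delta> :: real assume \<delta>: "0 < \<delta>"
    then have "\<forall>\<^sub>F n in sequentially. \<forall>x\<in>A. \<phi> n x \<le> \<delta> / 2" using r by (meson half_gt_zero)
    then show "\<forall>\<^sub>F n in sequentially. dist (SUP x\<in>A. \<phi> n x) 0 < \<delta>"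
    proof eventually_elim
      case (elim n)
      obtain a where a: "a \<in> A" using \<open>A \<noteq> {}\<close> by blast
      have "(SUP x\<in>A. \<phi> n x) \<le> \<delta> / 2" using elim \<open>A \<noteq> {}\<close> by (intro cSUP_least) auto
      moreover have "0 \<le> (SUP x\<in>A. \<phi> n x)"
        using cSUP_upper[OF a bdd] nonneg[of n a] by (rule order_trans[rotated])
      ultimately show ?case using \<delta> by simp
    qed
  qed
qed

lemma bdd_above_blinfun_image:
  fixes A :: "'a::real_normed_vector set" and f :: "'a \<Rightarrow>\<^sub>L real"
  assumes "bounded A"
  shows "bdd_above ((\<lambda>x. \<bar>blinfun_apply f x\<bar>) ` A)"
proof -
  have "bounded (blinfun_apply f ` A)"
    using assms by (rule bounded_linear_image) (rule blinfun.bounded_linear_right)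
  then show ?thesis by (force simp: bounded_iff intro: bdd_aboveI2)
qed

lemma bdd_above_blinfun_apply_image:
  fixes B :: "('a::real_normed_vector \<Rightarrow>\<^sub>L real) set"
  assumes "bounded B"
  shows "bdd_above ((\<lambda>f. \<bar>blinfun_apply f x\<bar>) ` B)"
proof -
  have "bounded ((\<lambda>f. blinfun_apply f x) ` B)"
    using assms by (rule bounded_linear_image) (rule blinfun.bounded_linear_left)
  then show ?thesis by (force simp: bounded_iff intro: bdd_aboveI2)
qed

text \<open>The disjoint_splitting lemma applied to the norm: an L-weakly compact set is, up to a small ball,
  contained in an order interval generated by its own elements.\<close>

lemma L_weakly_compact_approx:
  fixes A U :: "'a::banach_lattice set"
  assumes A: "L_weakly_compact A"
    and U: "0 \<in> U" "\<And>u x. u \<in> U \<Longrightarrow> x \<in> A \<Longrightarrow> u + \<bar>x\<bar> \<in> U"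
      "\<And>u c. u \<in> U \<Longrightarrow> 0 \<le> c \<Longrightarrow> c *\<^sub>R u \<in> U"
    and "0 < \<delta>"
  obtains u where "u \<in> U" "\<And>x. x \<in> A \<Longrightarrow> norm (pprt (\<bar>x\<bar> - u)) \<le> \<delta>"
proof (rule ccontr)
  assume contra: "\<not> thesis"
  have large: "\<exists>x\<in>abs ` A. \<delta> < norm (pprt (x - u))" if "u \<in> U" for u
    using contra that(1) \<open>\<And>u. u \<in> U \<Longrightarrow> (\<And>x. x \<in> A \<Longrightarrow> norm (pprt (\<bar>x\<bar> - u)) \<le> \<delta>) \<Longrightarrow> thesis\<close>
    by (meson imageI not_le)
  obtain M where M: "\<And>x. x \<in> A \<Longrightarrow> norm x \<le> M"
    using A by (auto simp: L_weakly_compact_def bounded_iff)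
  obtain v where v: "disjoint_seq v" "\<And>n. 0 \<le> v n" "\<And>n. \<exists>x\<in>abs ` A. v n \<le> x"
    "\<And>n. \<delta> / 2 < norm (v n)"
  proof (rule disjoint_splitting[of "abs ` A" M U norm 1 \<delta>])
    show "norm x \<le> norm y" if "0 \<le> x" "x \<le> y" for x y :: 'a
      using that order_trans[OF that] by (intro norm_mono_abs) (simp add: abs_of_nonneg)
    show "norm x \<le> M" if "x \<in> abs ` A" for x using that M by (auto simp: norm_abs)
  qed (use U large \<open>0 < \<delta>\<close> in \<open>auto simp: norm_triangle_ineq\<close>)
  have "v \<longlonglongrightarrow> 0" using L_weakly_compactD[OF A v(1,2)] v(3) by blast
  then have "\<forall>\<^sub>F n in sequentially. norm (v n) < \<delta> / 2"
    using \<open>0 < \<delta>\<close> by (auto dest!: tendstoD[of v 0 _ "\<delta> / 2"])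
  then obtain n where "norm (v n) < \<delta> / 2" by (auto simp: eventually_sequentially)
  then show False using v(4)[of n] by simp
qed

lemma abs_eq_inf_add_pprt:
  fixes x u :: "'a::banach_lattice"
  shows "x = inf x u + pprt (x - u)"
proof -
  have "x = (x - inf x u) + inf x u" by (simp only: diff_add_cancel)
  also have "\<dots> = inf x u + pprt (x - u)" by (simp only: diff_inf_eq_pprt add.commute)
  finally show ?thesis .
qed

lemma eventually_less_imp_LIMSEQ_0:
  fixes a :: "nat \<Rightarrow> real"
  assumes "\<And>n. 0 \<le> a n" "\<And>\<delta>. 0 < \<delta> \<Longrightarrow> \<exists>b. b \<longlonglongrightarrow> 0 \<and> (\<forall>n. a n \<le> b n + \<delta>)"
  shows "a \<longlonglongrightarrow> 0"
proof (rule tendstoI)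
  fix \<delta> :: real assume "0 < \<delta>"
  then obtain b where b: "b \<longlonglongrightarrow> 0" "\<And>n. a n \<le> b n + \<delta> / 2" using assms(2)[of "\<delta> / 2"] by auto
  have "\<forall>\<^sub>F n in sequentially. b n < \<delta> / 2"
    by (rule order_tendstoD(2)[OF b(1)]) (use \<open>0 < \<delta>\<close> in simp)
  then show "\<forall>\<^sub>F n in sequentially. dist (a n) 0 < \<delta>"
  proof eventually_elim
    case (elim n)
    then show ?case using b(2)[of n] assms(1)[of n] by simp
  qed
qed

section \<open>Uniform convergence on L-weakly compact sets\<close>

text \<open>\<open>\<bar>f n\<bar>\<close> is its truncation at \<open>u\<close>, which tends to
  zero at \<open>\<bar>a\<bar>\<close>, plus an excess that a suitable \<open>u\<close> makes small
  at \<open>\<bar>a\<bar>\<close> for all \<open>n\<close>. Without such a \<open>u\<close>,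
  disjoint functionals of norm at most \<open>M\<close>, all large at \<open>\<bar>a\<bar>\<close>,
  would give disjoint vectors below \<open>\<bar>a\<bar>\<close> with norm above
  \<open>\<delta> / 4 / M\<close>.\<close>

lemma uaw_star_null_apply_tendsto_0:
  fixes A :: "'a::banach_lattice set" and f :: "nat \<Rightarrow> 'a \<Rightarrow>\<^sub>L real"
  assumes A: "L_weakly_compact A" "a \<in> A" and f: "bounded (range f)" "uaw_star_null f"
  shows "(\<lambda>n. \<bar>f n\<bar> \<bar>a\<bar>) \<longlonglongrightarrow> 0"
proof (rule eventually_less_imp_LIMSEQ_0)
  obtain M where M: "0 < M" "\<And>n. norm (f n) \<le> M" using bounded_range_norm[OF f(1)] by blast
  fix \<delta> :: real assume \<delta>: "0 < \<delta>"
  have "\<exists>u\<ge>0. \<forall>n. blinfun_apply (pprt (\<bar>f n\<bar> - u)) \<bar>a\<bar> \<le> \<delta>"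
  proof (rule ccontr)
    assume contra: "\<not> ?thesis"
    have large: "\<exists>g\<in>range (\<lambda>n. \<bar>f n\<bar>). \<delta> < blinfun_apply (pprt (g - u)) \<bar>a\<bar>" if "u \<in> {u. 0 \<le> u}" for u
      using contra that by (auto simp: not_le)
    obtain g where g: "disjoint_seq g" "\<And>n. 0 \<le> g n" "\<And>n. \<exists>h\<in>range (\<lambda>n. \<bar>f n\<bar>). g n \<le> h"
      "\<And>n. \<delta> / 2 < g n \<bar>a\<bar>"
    proof (rule disjoint_splitting[of "range (\<lambda>n. \<bar>f n\<bar>)" M "{u. 0 \<le> u}" "\<lambda>g. g \<bar>a\<bar>" "norm \<bar>a\<bar>" \<delta>])
      show "blinfun_apply g \<bar>a\<bar> \<le> norm \<bar>a\<bar> * norm g" for g :: "'a \<Rightarrow>\<^sub>L real"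
        using blinfun_apply_le_norm[of g "norm g" "\<bar>a\<bar>"] by (simp add: mult.commute)
    qed (use large \<delta> M(2) in \<open>auto simp: norm_abs blinfun.add_left scaleR_nonneg_nonneg intro: blinfun_le_apply\<close>)
    have g_norm: "norm (g n) \<le> M" for n
    proof -
      obtain k where "g n \<le> \<bar>f k\<bar>" using g(3)[of n] by blast
      then have "norm (g n) \<le> norm (f k)" using g(2)[of n] by (intro norm_mono_abs) (simp add: abs_of_nonneg)
      then show ?thesis using M(2)[of k] by simp
    qed
    obtain v where v: "disjoint_seq v" "\<And>n. 0 \<le> v n" "\<And>n. v n \<le> \<bar>a\<bar>" "\<And>n. \<exists>m. \<delta> / 2 / 2 < g m (v n)"
      using disjoint_functionals_imp_disjoint_vectors[OF g(2,1) g_norm abs_ge_zero, of "\<delta> / 2" a]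
        \<delta> g(4) by (auto simp: less_imp_le)
    have "v \<longlonglongrightarrow> 0" using L_weakly_compactD[OF A(1) v(1,2)] v(3) A(2) by blast
    then have "\<forall>\<^sub>F n in sequentially. norm (v n) < \<delta> / 4 / M"
      using \<delta> M(1) tendstoD[of v 0 sequentially "\<delta> / 4 / M"] by simp
    then obtain n where n: "norm (v n) < \<delta> / 4 / M" by (auto simp: eventually_sequentially)
    obtain m where "\<delta> / 2 / 2 < g m (v n)" using v(4) by blast
    also have "\<dots> \<le> M * norm (v n)" by (rule blinfun_apply_le_norm[OF g_norm])
    finally show False using n M(1) by (simp add: field_simps)
  qed
  then obtain u where u: "0 \<le> u" "\<And>n. blinfun_apply (pprt (\<bar>f n\<bar> - u)) \<bar>a\<bar> \<le> \<delta>" by blast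
  have "(\<lambda>n. inf \<bar>f n\<bar> u \<bar>a\<bar>) \<longlonglongrightarrow> 0"
    using f(2) u(1) unfolding uaw_star_tendsto_def weak_star_tendsto_def by simp
  moreover have "\<bar>f n\<bar> \<bar>a\<bar> \<le> inf \<bar>f n\<bar> u \<bar>a\<bar> + \<delta>" for n
    by (subst abs_eq_inf_add_pprt[of "\<bar>f n\<bar>" u]) (simp add: blinfun.add_left u(2))
  ultimately show "\<exists>b. b \<longlonglongrightarrow> 0 \<and> (\<forall>n. \<bar>f n\<bar> \<bar>a\<bar> \<le> b n + \<delta>)" by blast
qed (simp add: blinfun_nonneg)

text \<open>Here the splitting argument yields disjoint vectors \<open>v n\<close> of norm at most
  \<open>M\<close> on which \<open>\<bar>b\<bar>\<close> is large. Restricting the one functional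
  \<open>\<bar>b\<bar>\<close> to their bands gives disjoint functionals below
  \<open>\<bar>b\<bar>\<close> that are not norm null.\<close>

lemma uaw_null_apply_tendsto_0:
  fixes B :: "('a::banach_lattice \<Rightarrow>\<^sub>L real) set" and x :: "nat \<Rightarrow> 'a"
  assumes B: "L_weakly_compact B" "b \<in> B" and x: "bounded (range x)" "uaw_null x"
  shows "(\<lambda>n. \<bar>b\<bar> \<bar>x n\<bar>) \<longlonglongrightarrow> 0"
proof (rule eventually_less_imp_LIMSEQ_0)
  obtain M where M: "0 < M" "\<And>n. norm (x n) \<le> M" using bounded_range_norm[OF x(1)] by blast
  fix \<delta> :: real assume \<delta>: "0 < \<delta>"
  have "\<exists>u\<ge>0. \<forall>n. \<bar>b\<bar> (pprt (\<bar>x n\<bar> - u)) \<le> \<delta>"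
  proof (rule ccontr)
    assume contra: "\<not> ?thesis"
    have large: "\<exists>y\<in>range (\<lambda>n. \<bar>x n\<bar>). \<delta> < \<bar>b\<bar> (pprt (y - u))" if "u \<in> {u. 0 \<le> u}" for u
      using contra that by (auto simp: not_le)
    obtain v where v: "disjoint_seq v" "\<And>n. 0 \<le> v n" "\<And>n. \<exists>y\<in>range (\<lambda>n. \<bar>x n\<bar>). v n \<le> y"
      "\<And>n. \<delta> / 2 < \<bar>b\<bar> (v n)"
    proof (rule disjoint_splitting[of "range (\<lambda>n. \<bar>x n\<bar>)" M "{u. 0 \<le> u}" "blinfun_apply \<bar>b\<bar>" "norm \<bar>b\<bar>" \<delta>])
      show "\<bar>b\<bar> y \<le> norm \<bar>b\<bar> * norm y" for y by (rule blinfun_apply_le_norm) simp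
    qed (use large \<delta> M(2) in \<open>auto simp: norm_abs blinfun.add_right scaleR_nonneg_nonneg intro: blinfun_mono\<close>)
    have v_norm: "norm (v n) \<le> M" for n
    proof -
      obtain k where "v n \<le> \<bar>x k\<bar>" using v(3)[of n] by blast
      then have "norm (v n) \<le> norm (x k)" using v(2)[of n] by (intro norm_mono_abs) (simp add: abs_of_nonneg)
      then show ?thesis using M(2)[of k] by simp
    qed
    obtain g where g: "disjoint_seq g" "\<And>n. 0 \<le> g n" "\<And>n. g n \<le> \<bar>b\<bar>" "\<And>n. g n (v n) = \<bar>b\<bar> (v n)"
      using disjoint_restrictions[of "\<lambda>_. \<bar>b\<bar>" v] v(1,2) by auto
    have "g \<longlonglongrightarrow> 0" using L_weakly_compactD[OF B(1) g(1,2)] g(3) B(2) by blast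
    then have "\<forall>\<^sub>F n in sequentially. norm (g n) < \<delta> / 2 / M"
      using \<delta> M(1) tendstoD[of g 0 sequentially "\<delta> / 2 / M"] by simp
    then obtain n where n: "norm (g n) < \<delta> / 2 / M" by (auto simp: eventually_sequentially)
    have "\<delta> / 2 < g n (v n)" using v(4) g(4) by simp
    also have "\<dots> \<le> norm (g n) * norm (v n)" by (rule blinfun_apply_le_norm) simp
    also have "\<dots> \<le> norm (g n) * M" by (intro mult_left_mono v_norm) simp
    finally show False using n M(1) by (simp add: field_simps)
  qed
  then obtain u where u: "0 \<le> u" "\<And>n. \<bar>b\<bar> (pprt (\<bar>x n\<bar> - u)) \<le> \<delta>" by blast
  have "(\<lambda>n. \<bar>b\<bar> (inf \<bar>x n\<bar> u)) \<longlonglongrightarrow> \<bar>b\<bar> 0"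
    using x(2) u(1) unfolding uaw_tendsto_def weak_tendsto_def by simp
  then have "(\<lambda>n. \<bar>b\<bar> (inf \<bar>x n\<bar> u)) \<longlonglongrightarrow> 0" by (simp add: blinfun.zero_right)
  moreover have "\<bar>b\<bar> \<bar>x n\<bar> \<le> \<bar>b\<bar> (inf \<bar>x n\<bar> u) + \<delta>" for n
    by (subst abs_eq_inf_add_pprt[of "\<bar>x n\<bar>" u]) (simp add: blinfun.add_right u(2))
  ultimately show "\<exists>c. c \<longlonglongrightarrow> 0 \<and> (\<forall>n. \<bar>b\<bar> \<bar>x n\<bar> \<le> c n + \<delta>)" by blast
qed (simp add: blinfun_nonneg)

lemma le_add_pprt_diff: "x \<le> u + pprt (x - u)" for x u :: "'a::banach_lattice"
  by (simp add: pprt_def add_sup_distrib_left)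

lemma L_weakly_compact_imp_uaw_star:
  fixes A :: "'a::banach_lattice set" and f :: "nat \<Rightarrow> 'a \<Rightarrow>\<^sub>L real"
  assumes A: "L_weakly_compact A" and f: "bounded (range f)" "uaw_star_null f" and "0 < \<delta>"
  shows "\<forall>\<^sub>F n in sequentially. \<forall>x\<in>A. \<bar>f n x\<bar> \<le> \<delta>"
proof -
  obtain M where M: "0 < M" "\<And>n. norm (f n) \<le> M" using bounded_range_norm[OF f(1)] by blast
  \<comment> \<open>The closure properties of \<open>U\<close> come from the pointwise result for
    members of \<open>A\<close>, so the \<open>u\<close> that approximates \<open>A\<close>
    uniformly also satisfies the convergence.\<close>
  define U where "U = {u. (\<lambda>n. \<bar>f n\<bar> u) \<longlonglongrightarrow> 0}"
  obtain u where u: "u \<in> U" "\<And>x. x \<in> A \<Longrightarrow> norm (pprt (\<bar>x\<bar> - u)) \<le> \<delta> / 2 / M"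
  proof (rule L_weakly_compact_approx[OF A, of U "\<delta> / 2 / M"])
    show "0 \<in> U" by (simp add: U_def blinfun.zero_right)
    show "u + \<bar>x\<bar> \<in> U" if "u \<in> U" "x \<in> A" for u x
      using tendsto_add[of "\<lambda>n. \<bar>f n\<bar> u" 0 sequentially "\<lambda>n. \<bar>f n\<bar> \<bar>x\<bar>" 0] that
        uaw_star_null_apply_tendsto_0[OF A that(2) f] by (simp add: U_def blinfun.add_right)
    show "c *\<^sub>R u \<in> U" if "u \<in> U" "0 \<le> c" for u c
      using tendsto_mult_left[of "\<lambda>n. \<bar>f n\<bar> u" 0 sequentially c] that
      by (simp add: U_def blinfun.scaleR_right)
  qed (use M \<open>0 < \<delta>\<close> in auto)
  have "\<forall>\<^sub>F n in sequentially. \<bar>f n\<bar> u < \<delta> / 2"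
    using u(1) order_tendstoD(2)[of "\<lambda>n. \<bar>f n\<bar> u" 0 sequentially "\<delta> / 2"] \<open>0 < \<delta>\<close> by (simp add: U_def)
  then show ?thesis
  proof eventually_elim
    case (elim n)
    show ?case
    proof
      fix x assume x: "x \<in> A"
      have "\<bar>f n x\<bar> \<le> \<bar>f n\<bar> \<bar>x\<bar>" by (rule abs_blinfun_apply_le)
      also have "\<dots> \<le> \<bar>f n\<bar> (u + pprt (\<bar>x\<bar> - u))" by (intro blinfun_mono le_add_pprt_diff) simp
      also have "\<dots> = \<bar>f n\<bar> u + \<bar>f n\<bar> (pprt (\<bar>x\<bar> - u))" by (rule blinfun.add_right)
      also have "\<bar>f n\<bar> (pprt (\<bar>x\<bar> - u)) \<le> M * norm (pprt (\<bar>x\<bar> - u))"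
        by (rule blinfun_apply_le_norm) (simp add: norm_abs M)
      also have "\<dots> \<le> M * (\<delta> / 2 / M)" using M u(2)[OF x] by (intro mult_left_mono) auto
      finally show "\<bar>f n x\<bar> \<le> \<delta>" using elim M(1) by simp
    qed
  qed
qed

lemma L_weakly_compact_imp_uaw:
  fixes B :: "('a::banach_lattice \<Rightarrow>\<^sub>L real) set" and x :: "nat \<Rightarrow> 'a"
  assumes B: "L_weakly_compact B" and x: "bounded (range x)" "uaw_null x" and "0 < \<delta>"
  shows "\<forall>\<^sub>F n in sequentially. \<forall>b\<in>B. \<bar>blinfun_apply b (x n)\<bar> \<le> \<delta>"
proof -
  obtain M where M: "0 < M" "\<And>n. norm (x n) \<le> M" using bounded_range_norm[OF x(1)] by blast
  define U where "U = {u :: 'a \<Rightarrow>\<^sub>L real. (\<lambda>n. u \<bar>x n\<bar>) \<longlonglongrightarrow> 0}"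
  obtain u where u: "u \<in> U" "\<And>b. b \<in> B \<Longrightarrow> norm (pprt (\<bar>b\<bar> - u)) \<le> \<delta> / 2 / M"
  proof (rule L_weakly_compact_approx[OF B, of U "\<delta> / 2 / M"])
    show "0 \<in> U" by (simp add: U_def)
    show "u + \<bar>b\<bar> \<in> U" if "u \<in> U" "b \<in> B" for u b
      using tendsto_add[of "\<lambda>n. u \<bar>x n\<bar>" 0 sequentially "\<lambda>n. \<bar>b\<bar> \<bar>x n\<bar>" 0] that
        uaw_null_apply_tendsto_0[OF B that(2) x] by (simp add: U_def blinfun.add_left)
    show "c *\<^sub>R u \<in> U" if "u \<in> U" "0 \<le> c" for u c
      using tendsto_mult_left[of "\<lambda>n. u \<bar>x n\<bar>" 0 sequentially c] that
      by (simp add: U_def blinfun.scaleR_left)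
  qed (use M \<open>0 < \<delta>\<close> in auto)
  have "\<forall>\<^sub>F n in sequentially. u \<bar>x n\<bar> < \<delta> / 2"
    using u(1) order_tendstoD(2)[of "\<lambda>n. u \<bar>x n\<bar>" 0 sequentially "\<delta> / 2"] \<open>0 < \<delta>\<close> by (simp add: U_def)
  then show ?thesis
  proof eventually_elim
    case (elim n)
    show ?case
    proof
      fix b assume b: "b \<in> B"
      have "\<bar>blinfun_apply b (x n)\<bar> \<le> \<bar>b\<bar> \<bar>x n\<bar>" by (rule abs_blinfun_apply_le)
      also have "\<dots> \<le> blinfun_apply (u + pprt (\<bar>b\<bar> - u)) \<bar>x n\<bar>" by (intro blinfun_le_apply le_add_pprt_diff) simp
      also have "\<dots> = u \<bar>x n\<bar> + blinfun_apply (pprt (\<bar>b\<bar> - u)) \<bar>x n\<bar>" by (rule blinfun.add_left)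
      also have "blinfun_apply (pprt (\<bar>b\<bar> - u)) \<bar>x n\<bar> \<le> \<delta> / 2 / M * norm \<bar>x n\<bar>"
        by (rule blinfun_apply_le_norm) (rule u(2)[OF b])
      also have "\<dots> \<le> \<delta> / 2 / M * M" using M \<open>0 < \<delta>\<close> by (intro mult_left_mono) (auto simp: norm_abs)
      finally show "\<bar>blinfun_apply b (x n)\<bar> \<le> \<delta>" using elim M(1) by simp
    qed
  qed
qed

section \<open>Disjoint witnesses against L-weak compactness\<close>

text \<open>Norming functionals of the \<open>x n\<close> become disjoint by restriction to the
  bands of the \<open>x n\<close>. They are then large at \<open>\<bar>a n\<bar>\<close>, and
  \<open>functional_attaining_abs\<close> moves this value to \<open>a n\<close> itself.\<close>

lemma not_L_weakly_compact_imp_disjoint_functionals: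
  fixes A :: "'a::banach_lattice set"
  assumes "bounded A" "\<not> L_weakly_compact A"
  obtains h :: "nat \<Rightarrow> 'a \<Rightarrow>\<^sub>L real" and \<epsilon> where "0 < \<epsilon>" "disjoint_seq h" "bounded (range h)"
    "\<And>n. \<exists>a\<in>A. \<epsilon> \<le> \<bar>h n a\<bar>"
proof -
  obtain x \<epsilon> where x: "0 < \<epsilon>" "disjoint_seq x" "\<And>n. 0 \<le> x n" "\<And>n. \<epsilon> \<le> norm (x n)"
    "\<And>n. \<exists>a\<in>A. x n \<le> \<bar>a\<bar>"
    by (rule not_L_weakly_compactD[OF assms]) blast
  have "\<exists>f :: 'a \<Rightarrow>\<^sub>L real. 0 \<le> f \<and> norm f \<le> 1 \<and> blinfun_apply f (x n) = norm (x n)" for n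
    by (rule norming_functional[OF x(3)[of n]]) blast
  then obtain f :: "nat \<Rightarrow> 'a \<Rightarrow>\<^sub>L real" where f: "\<And>n. 0 \<le> f n" "\<And>n. norm (f n) \<le> 1"
      "\<And>n. f n (x n) = norm (x n)" by metis
  obtain g where g: "disjoint_seq g" "\<And>n. 0 \<le> g n" "\<And>n. g n \<le> f n" "\<And>n. g n (x n) = f n (x n)"
    using disjoint_restrictions[of f x] f(1) x(2,3) by auto
  obtain a where a: "\<And>n. a n \<in> A" "\<And>n. x n \<le> \<bar>a n\<bar>" using x(5) by metis
  have "\<exists>h. \<bar>h\<bar> \<le> g n \<and> blinfun_apply h (a n) = g n \<bar>a n\<bar>" for n
    by (rule functional_attaining_abs[OF g(2)[of n]]) blast
  then obtain h where h: "\<And>n. \<bar>h n\<bar> \<le> g n" "\<And>n. h n (a n) = g n \<bar>a n\<bar>" by metis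
  show ?thesis
  proof (rule that[of \<epsilon> h])
    show "disjoint_seq h"
      by (rule disjoint_seq_mono[OF g(1)]) (use h(1) g(2) in \<open>simp add: abs_of_nonneg\<close>)
    have "norm (h n) \<le> 1" for n
    proof -
      have "\<bar>h n\<bar> \<le> f n" using h(1) g(3) by (rule order_trans)
      then have "norm (h n) \<le> norm (f n)" using f(1) by (intro norm_mono_abs) (simp add: abs_of_nonneg)
      then show ?thesis using f(2)[of n] by simp
    qed
    then show "bounded (range h)" by (auto simp: bounded_iff)
    fix n
    have "\<epsilon> \<le> g n (x n)" using x(4)[of n] g(4) f(3) by simp
    also have "\<dots> \<le> g n \<bar>a n\<bar>" by (rule blinfun_mono[OF g(2) a(2)])
    also have "\<dots> = h n (a n)" by (simp add: h(2))
    also have "\<dots> \<le> \<bar>h n (a n)\<bar>" by simp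
    finally show "\<exists>a\<in>A. \<epsilon> \<le> \<bar>h n a\<bar>" using a(1)[of n] by blast
  qed (rule x(1))
qed

text \<open>For positive \<open>f\<close>, replacing \<open>x\<close> by
  \<open>\<bar>x\<bar>\<close> does not decrease \<open>\<bar>f x\<bar>\<close>, so positive vectors
  suffice to compute the norm.\<close>

lemma almost_norming_vector:
  fixes f :: "'a::banach_lattice \<Rightarrow>\<^sub>L real"
  assumes f: "0 \<le> f" and "c < norm f" "0 \<le> c"
  obtains y where "0 \<le> y" "norm y \<le> 1" "c < f y"
proof (rule ccontr)
  assume "\<not> thesis"
  then have small: "f y \<le> c" if "0 \<le> y" "norm y \<le> 1" for y
    using that \<open>\<And>y. 0 \<le> y \<Longrightarrow> norm y \<le> 1 \<Longrightarrow> c < f y \<Longrightarrow> thesis\<close> by force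
  have "norm f \<le> c"
  proof (rule norm_blinfun_bound[OF \<open>0 \<le> c\<close>])
    fix x
    show "norm (f x) \<le> c * norm x"
    proof (cases "x = 0")
      case False
      have "f (inverse (norm x) *\<^sub>R \<bar>x\<bar>) \<le> c"
        using False by (intro small) (auto simp: norm_abs scaleR_nonneg_nonneg)
      then have "f \<bar>x\<bar> \<le> c * norm x" using False by (simp add: blinfun.scaleR_right field_simps)
      then show ?thesis using abs_blinfun_apply_le[of f x] f by (simp add: abs_of_nonneg)
    qed (simp add: blinfun.zero_right)
  qed
  then show False using \<open>c < norm f\<close> by simp
qed

text \<open>Vectors nearly norming the disjoint \<open>f n\<close> need not be disjoint. The
  dichotomy is therefore applied to the positive part of the unit ball with \<open>\<rho>\<close>
  the supremum of all \<open>f n\<close>. Either some \<open>u\<close> captures this set up to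
  \<open>\<epsilon> / 4\<close>, and the \<open>f n\<close>, all large at \<open>u\<close>, give
  disjoint vectors below \<open>u\<close>; or disjoint vectors appear in the ball directly.\<close>

lemma not_L_weakly_compact_imp_disjoint_vectors:
  fixes B :: "('a::banach_lattice \<Rightarrow>\<^sub>L real) set"
  assumes "bounded B" "\<not> L_weakly_compact B"
  obtains x :: "nat \<Rightarrow> 'a" and \<epsilon> where "0 < \<epsilon>" "disjoint_seq x" "bounded (range x)"
    "\<And>n. \<exists>b\<in>B. \<epsilon> \<le> \<bar>blinfun_apply b (x n)\<bar>"
proof -
  obtain f \<epsilon> where f: "0 < \<epsilon>" "disjoint_seq f" "\<And>n. 0 \<le> f n" "\<And>n. \<epsilon> \<le> norm (f n)"
    "\<And>n. \<exists>b\<in>B. f n \<le> \<bar>b\<bar>"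
    by (rule not_L_weakly_compactD[OF assms]) blast
  obtain C where C: "\<And>b. b \<in> B \<Longrightarrow> norm b \<le> C" using assms(1) by (auto simp: bounded_iff)
  have f_norm: "norm (f n) \<le> C" for n
  proof -
    obtain b where b: "b \<in> B" "f n \<le> \<bar>b\<bar>" using f(5) by blast
    then have "norm (f n) \<le> norm b" using f(3)[of n] by (intro norm_mono_abs) (simp add: abs_of_nonneg)
    then show ?thesis using C[OF b(1)] by simp
  qed
  define X where "X = {x :: 'a. 0 \<le> x \<and> norm x \<le> 1}"
  define \<rho> where "\<rho> v = (SUP n. f n v)" for v
  have f_le: "f n v \<le> C * norm v" for n v by (rule blinfun_apply_le_norm[OF f_norm])
  have \<rho>_ge: "f n v \<le> \<rho> v" for n v
    unfolding \<rho>_def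
    by (rule cSUP_upper[OF UNIV_I]) (rule bdd_aboveI2[OF f_le])
  have \<rho>_le: "\<rho> v \<le> c" if "\<And>n. f n v \<le> c" for v c
    unfolding \<rho>_def using that by (intro cSUP_least) auto
  have \<rho>_gt: "\<exists>n. c < f n v" if "c < \<rho> v" for c v
    using \<rho>_le[of v c] that by (meson not_le)
  have "\<exists>v M. disjoint_seq v \<and> (\<forall>n. 0 \<le> v n \<and> norm (v n) \<le> M) \<and> (\<forall>n. \<exists>m. \<epsilon> / 8 < f m (v n))"
  proof (cases "\<exists>u\<ge>0. \<forall>x\<in>X. \<rho> (pprt (x - u)) \<le> \<epsilon> / 4")
    case True
    then obtain u where u: "0 \<le> u" "\<And>x. x \<in> X \<Longrightarrow> \<rho> (pprt (x - u)) \<le> \<epsilon> / 4" by blast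
    \<comment> \<open>A positive vector of the unit ball at which \<open>f n\<close> exceeds
      \<open>\<epsilon> / 2\<close> loses at most \<open>\<epsilon> / 4\<close> on its excess over
      \<open>u\<close>.\<close>
    have fu: "\<epsilon> / 4 \<le> f n u" for n
    proof -
      have "\<epsilon> / 2 < norm (f n)" "0 \<le> \<epsilon> / 2" using f(1) f(4)[of n] by auto
      then obtain y where y: "0 \<le> y" "norm y \<le> 1" "\<epsilon> / 2 < f n y"
        using almost_norming_vector[OF f(3)] by metis
      have "f n y \<le> f n (u + pprt (y - u))" by (rule blinfun_mono[OF f(3) le_add_pprt_diff])
      also have "\<dots> = f n u + f n (pprt (y - u))" by (rule blinfun.add_right)
      also have "f n (pprt (y - u)) \<le> \<epsilon> / 4"
        using \<rho>_ge[of n "pprt (y - u)"] u(2)[of y] y by (simp add: X_def)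
      finally show ?thesis using y(3) by simp
    qed
    obtain v where v: "disjoint_seq v" "\<And>n. 0 \<le> v n" "\<And>n. v n \<le> u" "\<And>n. \<exists>m. \<epsilon> / 4 / 2 < f m (v n)"
      using disjoint_functionals_imp_disjoint_vectors[OF f(3,2) f_norm u(1) _ fu] f(1) by auto
    have "norm (v n) \<le> norm u" for n
      using v(2,3)[of n] u(1) by (intro norm_mono_abs) (simp add: abs_of_nonneg)
    then show ?thesis using v by (intro exI[of _ v] exI[of _ "norm u"]) auto
  next
    case False
    have large: "\<exists>x\<in>X. \<epsilon> / 4 < \<rho> (pprt (x - u))" if "u \<in> {u. 0 \<le> u}" for u
      using False that by (auto simp: not_le)
    obtain v where v: "disjoint_seq v" "\<And>n. 0 \<le> v n" "\<And>n. \<exists>x\<in>X. v n \<le> x" "\<And>n. \<epsilon> / 4 / 2 < \<rho> (v n)"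
    proof (rule disjoint_splitting[of X 1 "{u. 0 \<le> u}" \<rho> C "\<epsilon> / 4"])
      show "\<rho> x \<le> \<rho> y" if "0 \<le> x" "x \<le> y" for x y
      proof (rule \<rho>_le)
        fix n show "f n x \<le> \<rho> y" using blinfun_mono[OF f(3) that(2)] \<rho>_ge by (rule order_trans)
      qed
      show "\<rho> (x + y) \<le> \<rho> x + \<rho> y" for x y
        using \<rho>_ge[of _ x] \<rho>_ge[of _ y] by (intro \<rho>_le) (simp add: blinfun.add_right add_mono)
      show "\<rho> x \<le> C * norm x" for x by (rule \<rho>_le) (rule f_le)
    qed (use large f(1) in \<open>auto simp: X_def scaleR_nonneg_nonneg\<close>)
    have "norm (v n) \<le> 1" for n
    proof -
      obtain x where x: "x \<in> X" "v n \<le> x" using v(3) by blast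
      then have "norm (v n) \<le> norm x"
        using v(2)[of n] by (intro norm_mono_abs) (simp add: abs_of_nonneg X_def)
      then show ?thesis using x(1) by (simp add: X_def)
    qed
    moreover have "\<exists>m. \<epsilon> / 8 < f m (v n)" for n using \<rho>_gt[OF v(4)[of n]] by simp
    ultimately show ?thesis using v(1,2) by blast
  qed
  then obtain v M where v: "disjoint_seq v" "\<And>n. 0 \<le> v n" "\<And>n. norm (v n) \<le> M"
    "\<And>n. \<exists>m. \<epsilon> / 8 < f m (v n)" by blast
  \<comment> \<open>Passes from \<open>\<bar>b\<bar>\<close> to \<open>b\<close>: the value
    \<open>\<bar>b\<bar> (v n)\<close> exceeds \<open>\<epsilon> / 8\<close>, and \<open>b\<close>
    comes within \<open>\<epsilon> / 16\<close> of it at some \<open>w\<close> between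
    \<open>- v n\<close> and \<open>v n\<close>.\<close>
  have "\<exists>w. \<bar>w\<bar> \<le> v n \<and> (\<exists>b\<in>B. \<epsilon> / 16 \<le> \<bar>blinfun_apply b w\<bar>)" for n
  proof -
    obtain m where m: "\<epsilon> / 8 < f m (v n)" using v(4) by blast
    obtain b where b: "b \<in> B" "f m \<le> \<bar>b\<bar>" using f(5) by blast
    obtain w where w: "\<bar>w\<bar> \<le> v n" "\<bar>b\<bar> (v n) < b w + \<epsilon> / 16"
      using abs_blinfun_approx[OF v(2)[of n], of "\<epsilon> / 16" b] f(1) by auto
    have "f m (v n) \<le> \<bar>b\<bar> (v n)" by (rule blinfun_le_apply[OF b(2) v(2)])
    then have "\<epsilon> / 16 \<le> \<bar>blinfun_apply b w\<bar>" using m w(2) by linarith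
    then show ?thesis using w(1) b(1) by blast
  qed
  then obtain w where w: "\<And>n. \<bar>w n\<bar> \<le> v n" "\<And>n. \<exists>b\<in>B. \<epsilon> / 16 \<le> \<bar>blinfun_apply b (w n)\<bar>" by metis
  show ?thesis
  proof (rule that[of "\<epsilon> / 16" w])
    show "disjoint_seq w"
      by (rule disjoint_seq_mono[OF v(1)]) (use w(1) v(2) in \<open>simp add: abs_of_nonneg\<close>)
    have "norm (w n) \<le> M" for n
    proof -
      have "norm (w n) \<le> norm (v n)" using w(1)[of n] v(2)[of n] by (intro norm_mono_abs) (simp add: abs_of_nonneg)
      then show ?thesis using v(3)[of n] by simp
    qed
    then show "bounded (range w)" by (auto simp: bounded_iff)
  qed (use f(1) w(2) in auto)
qed

section \<open>Sequential characterizations of L-weakly compact sets\<close>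

theorem theorem2p2:
  fixes A :: "'e::banach_lattice set" and B :: "('e \<Rightarrow>\<^sub>L real) set"
  shows
    "(A \<noteq> {} \<and> bounded A \<longrightarrow>
       (L_weakly_compact A \<longleftrightarrow>
          (\<forall>x' :: nat \<Rightarrow> 'e \<Rightarrow>\<^sub>L real. bounded (range x') \<and> uaw_star_null x' \<longrightarrow>
             (\<lambda>n. SUP x\<in>A. \<bar>blinfun_apply (x' n) x\<bar>) \<longlonglongrightarrow> 0)) \<and>
       (L_weakly_compact A \<longleftrightarrow>
          (\<forall>x' :: nat \<Rightarrow> 'e \<Rightarrow>\<^sub>L real. bounded (range x') \<and> uaw_null x' \<longrightarrow>
             (\<lambda>n. SUP x\<in>A. \<bar>blinfun_apply (x' n) x\<bar>) \<longlonglongrightarrow> 0)) \<and>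
       (L_weakly_compact A \<longleftrightarrow>
          (\<forall>x' :: nat \<Rightarrow> 'e \<Rightarrow>\<^sub>L real. bounded (range x') \<and> uo_null x' \<longrightarrow>
             (\<lambda>n. SUP x\<in>A. \<bar>blinfun_apply (x' n) x\<bar>) \<longlonglongrightarrow> 0)))
     \<and>
     (B \<noteq> {} \<and> bounded B \<longrightarrow>
       (L_weakly_compact B \<longleftrightarrow>
          (\<forall>x :: nat \<Rightarrow> 'e. bounded (range x) \<and> uaw_null x \<longrightarrow>
             (\<lambda>n. SUP x'\<in>B. \<bar>blinfun_apply x' (x n)\<bar>) \<longlonglongrightarrow> 0)))"
proof (intro conjI impI)
  assume A: "A \<noteq> {} \<and> bounded A"
  let ?conv = "\<lambda>x' :: nat \<Rightarrow> 'e \<Rightarrow>\<^sub>L real. (\<lambda>n. SUP x\<in>A. \<bar>blinfun_apply (x' n) x\<bar>) \<longlonglongrightarrow> 0"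
  have conv_iff: "?conv x' \<longleftrightarrow> (\<forall>\<delta>>0. \<forall>\<^sub>F n in sequentially. \<forall>x\<in>A. \<bar>blinfun_apply (x' n) x\<bar> \<le> \<delta>)" for x'
    using A by (intro SUP_tendsto_0_iff) (auto intro: bdd_above_blinfun_image)
  have imp: "?conv x'" if "L_weakly_compact A" "bounded (range x')" "uaw_star_null x'" for x'
    unfolding conv_iff using L_weakly_compact_imp_uaw_star[OF that] by blast
  \<comment> \<open>It suffices to test disjoint sequences, which are null in all three senses.
    Since \<open>uaw\<close>-null and \<open>uo\<close>-null sequences are null in the weak-star
    sense of \<open>imp\<close>, the two facts together give all three equivalences.\<close>
  have disj: "L_weakly_compact A"
    if conv: "\<And>x'. bounded (range x') \<Longrightarrow> disjoint_seq x' \<Longrightarrow> ?conv x'"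
  proof (rule ccontr)
    assume not: "\<not> L_weakly_compact A"
    obtain h :: "nat \<Rightarrow> 'e \<Rightarrow>\<^sub>L real" and \<epsilon> where h: "0 < \<epsilon>" "disjoint_seq h"
      "bounded (range h)" "\<And>n. \<exists>a\<in>A. \<epsilon> \<le> \<bar>h n a\<bar>"
      by (rule not_L_weakly_compact_imp_disjoint_functionals[OF conjunct2[OF A] not]) blast
    have "\<forall>\<^sub>F n in sequentially. \<forall>x\<in>A. \<bar>h n x\<bar> \<le> \<epsilon> / 2"
      using conv[OF h(3,2)] half_gt_zero[OF h(1)] unfolding conv_iff by blast
    then obtain n where "\<forall>x\<in>A. \<bar>h n x\<bar> \<le> \<epsilon> / 2" by (auto simp: eventually_sequentially)
    then show False using h(4)[of n] h(1) by force
  qed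
  show "L_weakly_compact A \<longleftrightarrow> (\<forall>x'. bounded (range x') \<and> uaw_star_null x' \<longrightarrow> ?conv x')"
    using imp disj disjoint_seq_uaw_null uaw_null_imp_uaw_star_null by blast
  show "L_weakly_compact A \<longleftrightarrow> (\<forall>x'. bounded (range x') \<and> uaw_null x' \<longrightarrow> ?conv x')"
    using imp disj disjoint_seq_uaw_null uaw_null_imp_uaw_star_null by blast
  show "L_weakly_compact A \<longleftrightarrow> (\<forall>x'. bounded (range x') \<and> uo_null x' \<longrightarrow> ?conv x')"
    using imp disj disjoint_seq_uo_null_dual uo_null_imp_uaw_star_null by blast
next
  assume B: "B \<noteq> {} \<and> bounded B"
  let ?conv = "\<lambda>x :: nat \<Rightarrow> 'e. (\<lambda>n. SUP x'\<in>B. \<bar>blinfun_apply x' (x n)\<bar>) \<longlonglongrightarrow> 0"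
  have conv_iff: "?conv x \<longleftrightarrow> (\<forall>\<delta>>0. \<forall>\<^sub>F n in sequentially. \<forall>x'\<in>B. \<bar>blinfun_apply x' (x n)\<bar> \<le> \<delta>)" for x
    using B by (intro SUP_tendsto_0_iff) (auto intro: bdd_above_blinfun_apply_image)
  show "L_weakly_compact B \<longleftrightarrow> (\<forall>x. bounded (range x) \<and> uaw_null x \<longrightarrow> ?conv x)"
  proof (intro iffI allI impI)
    fix x :: "nat \<Rightarrow> 'e" assume "L_weakly_compact B" "bounded (range x) \<and> uaw_null x"
    then show "?conv x" by (simp add: conv_iff L_weakly_compact_imp_uaw)
  next
    assume conv: "\<forall>x. bounded (range x) \<and> uaw_null x \<longrightarrow> ?conv x"
    show "L_weakly_compact B"
    proof (rule ccontr)
      assume not: "\<not> L_weakly_compact B"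
      obtain x :: "nat \<Rightarrow> 'e" and \<epsilon> where x: "0 < \<epsilon>" "disjoint_seq x"
        "bounded (range x)" "\<And>n. \<exists>b\<in>B. \<epsilon> \<le> \<bar>blinfun_apply b (x n)\<bar>"
        by (rule not_L_weakly_compact_imp_disjoint_vectors[OF conjunct2[OF B] not]) blast
      have "\<forall>\<^sub>F n in sequentially. \<forall>b\<in>B. \<bar>blinfun_apply b (x n)\<bar> \<le> \<epsilon> / 2"
        using conv x(3) disjoint_seq_uaw_null[OF x(2)] half_gt_zero[OF x(1)] unfolding conv_iff by blast
      then obtain n where "\<forall>b\<in>B. \<bar>blinfun_apply b (x n)\<bar> \<le> \<epsilon> / 2" by (auto simp: eventually_sequentially)
      then show False using x(4)[of n] x(1) by force
    qed
  qed
qed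

end
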